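(* Let $(\pi,\mathcal H)$ be a unitary representation of a Lie group $H$. Assume that there exist an $H$-equivariant holomorphic line bundle $\mathcal L\to D$ over a complex manifold $D$ and an anti-holomorphic involutive diffeomorphism $\sigma$ of $D$ with the following three conditions: (a) There is an injective (continuous) $H$-intertwining map $\mathcal H\to\mathcal O(\mathcal L)$. (b) There exists an isomorphism of $H$-equivariant holomorphic line bundles $\Psi:\mathcal L\xrightarrow{\ \sim\ }\overline{\sigma^*\mathcal L}$. (c) Given $x\in D$, there exists $g\in H$ such that $\sigma(x)=g\cdot x$. Then the ring $\operatorname{End}_H(\mathcal H)$ of continuous $H$-intertwining operators on $\mathcal H$ is commutative. Consequently, $(\pi,\mathcal H)$ is multiplicity-free.
   Context: $\mathcal O(\mathcal L)=\mathcal O(D,\mathcal L)$ is the space of holomorphic sections of $\mathcal L\to D$, with the Fréchet topology of uniform convergence on compact sets. The Lie group $H$ acts holomorphically and equivariantly on the holomorphic line bundle $\mathcal L\to D$, and hence acts on $\mathcal O(\mathcal L)$ by pull-back of sections. If a complex line bundle has transition functions $g_{\alpha\beta}$, its conjugate bundle (denoted by an overline) is the complex line bundle with transition functions $\overline{g_{\alpha\beta}}$. For the anti-holomorphic diffeomorphism $\sigma$ of $D$, the pull-back $\sigma^*\mathcal L\to D$ is an anti-holomorphic line bundle, and $\overline{\sigma^*\mathcal L}\to D$ is in turn a holomorphic line bundle. A unitary representation $(\pi,\mathcal H)$ of $H$ is called multiplicity-free if the ring $\operatorname{End}_H(\mathcal H)$ is commutative.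
   Formalization: The complex manifold D is assumed connected; without this the claim fails (D two points, H trivial, σ = id, L trivial, Hilbert space ℂ² = O(L), whose commutant is M₂(ℂ)). *)

theory Defs
  imports "HOL-Analysis.Analysis" "HOL-Algebra.Algebra"
begin

section \<open>Complex normed spaces and Hilbert spaces\<close>

class complex_normed_vector = real_normed_vector +
  fixes scaleC :: "complex \<Rightarrow> 'a \<Rightarrow> 'a"  (infixr "*\<^sub>C" 75)
  assumes scaleC_add_right: "c *\<^sub>C (x + y) = c *\<^sub>C x + c *\<^sub>C y"
    and scaleC_add_left: "(c + d) *\<^sub>C x = c *\<^sub>C x + d *\<^sub>C x"
    and scaleC_scaleC: "c *\<^sub>C d *\<^sub>C x = (c * d) *\<^sub>C x"
    and scaleC_of_real: "complex_of_real r *\<^sub>C x = r *\<^sub>R x"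
    and norm_scaleC: "norm (c *\<^sub>C x) = cmod c * norm x"

instantiation complex :: complex_normed_vector
begin
definition scaleC_complex :: "complex \<Rightarrow> complex \<Rightarrow> complex" where
  "scaleC_complex c x = c * x"
instance
  by standard (auto simp: scaleC_complex_def algebra_simps norm_mult scaleR_conv_of_real)
end

instantiation prod :: (complex_normed_vector, complex_normed_vector) complex_normed_vector
begin
definition scaleC_prod :: "complex \<Rightarrow> 'a \<times> 'b \<Rightarrow> 'a \<times> 'b" where
  "scaleC_prod c p = (c *\<^sub>C fst p, c *\<^sub>C snd p)"
instance
proof
  fix c :: complex and x :: "'a \<times> 'b"
  have "norm (c *\<^sub>C x) = sqrt ((cmod c)\<^sup>2 * ((norm (fst x))\<^sup>2 + (norm (snd x))\<^sup>2))"
    by (simp add: scaleC_prod_def norm_prod_def norm_scaleC power_mult_distrib distrib_left)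
  then show "norm (c *\<^sub>C x) = cmod c * norm x"
    by (simp add: norm_prod_def real_sqrt_mult)
qed (auto simp: scaleC_prod_def scaleC_add_right scaleC_add_left scaleC_scaleC scaleC_of_real
      scaleR_prod_def)
end

class chilbert_space = complex_normed_vector + complete_space +
  fixes cinner :: "'a \<Rightarrow> 'a \<Rightarrow> complex"
  assumes cinner_commute: "cinner x y = cnj (cinner y x)"
    and cinner_add_left: "cinner (x + y) z = cinner x z + cinner y z"
    and cinner_scaleC_left: "cinner (c *\<^sub>C x) y = c * cinner x y"
    and cinner_self: "cinner x x = complex_of_real ((norm x)\<^sup>2)"

section \<open>Smooth, holomorphic and anti-holomorphic maps between open sets\<close>

text \<open>The sets \<open>S\<close> below are always open. On a finite-dimensional domain, \<open>Ck_on k\<close> is the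
  usual class of \<open>k\<close> times continuously differentiable maps.\<close>

primrec Ck_on :: "nat \<Rightarrow> 'a::real_normed_vector set \<Rightarrow> ('a \<Rightarrow> 'b::real_normed_vector) \<Rightarrow> bool" where
  "Ck_on 0 S f \<longleftrightarrow> continuous_on S f"
| "Ck_on (Suc k) S f \<longleftrightarrow> (\<forall>x\<in>S. f differentiable (at x)) \<and>
     (\<forall>v. Ck_on k S (\<lambda>x. frechet_derivative f (at x) v))"

definition smooth_on :: "'a::real_normed_vector set \<Rightarrow> ('a \<Rightarrow> 'b::real_normed_vector) \<Rightarrow> bool" where
  "smooth_on S f \<longleftrightarrow> (\<forall>k. Ck_on k S f)"

definition holo_on ::
    "'a::complex_normed_vector set \<Rightarrow> ('a \<Rightarrow> 'b::complex_normed_vector) \<Rightarrow> bool" where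
  "holo_on S f \<longleftrightarrow> (\<forall>x\<in>S. \<exists>f'. (f has_derivative f') (at x) \<and> (\<forall>c v. f' (c *\<^sub>C v) = c *\<^sub>C f' v))"

definition antiholo_on ::
    "'a::complex_normed_vector set \<Rightarrow> ('a \<Rightarrow> 'b::complex_normed_vector) \<Rightarrow> bool" where
  "antiholo_on S f \<longleftrightarrow>
     (\<forall>x\<in>S. \<exists>f'. (f has_derivative f') (at x) \<and> (\<forall>c v. f' (c *\<^sub>C v) = cnj c *\<^sub>C f' v))"

section \<open>Manifolds\<close>

text \<open>A chart is a domain together with a coordinate map into a normed space. The model spaces
  are finite-dimensional normed spaces instead of \<open>real ^ 'n\<close> and \<open>complex ^ 'n\<close>, because index
  types are nonempty and would exclude dimension 0 (in particular discrete groups).\<close>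

type_synonym ('a, 'e) chart = "'a set \<times> ('a \<Rightarrow> 'e)"

text \<open>The class of maps \<open>C\<close> is \<^const>\<open>smooth_on\<close>, \<^const>\<open>holo_on\<close> or \<^const>\<open>antiholo_on\<close>.
  Openness of the domains of all local expressions is continuity with respect to the topologies
  defined by the two atlases.\<close>

definition manifold_map ::
    "('e::topological_space set \<Rightarrow> ('e \<Rightarrow> 'f) \<Rightarrow> bool) \<Rightarrow>
     ('a, 'e) chart set \<Rightarrow> ('b, 'f) chart set \<Rightarrow> ('a \<Rightarrow> 'b) \<Rightarrow> bool" where
  "manifold_map C A B F \<longleftrightarrow> F ` (\<Union>(fst ` A)) \<subseteq> \<Union>(fst ` B) \<and>
     (\<forall>(U, \<phi>)\<in>A. \<forall>(V, \<psi>)\<in>B. open (\<phi> ` (U \<inter> F -` V)) \<and>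
        C (\<phi> ` (U \<inter> F -` V)) (\<psi> \<circ> F \<circ> inv_into U \<phi>))"

abbreviation "smooth_map \<equiv> manifold_map smooth_on"
abbreviation "holomorphic_map \<equiv> manifold_map holo_on"
abbreviation "antiholomorphic_map \<equiv> manifold_map antiholo_on"

definition manifold_atlas ::
    "('e::real_normed_vector set \<Rightarrow> ('e \<Rightarrow> 'e) \<Rightarrow> bool) \<Rightarrow>
     ('a::{t2_space, second_countable_topology}, 'e) chart set \<Rightarrow> bool" where
  "manifold_atlas C A \<longleftrightarrow>
     (\<exists>B::'e set. finite B \<and> span B = UNIV) \<and>
     \<Union>(fst ` A) = UNIV \<and>
     (\<forall>(U, \<phi>)\<in>A. open U \<and> open (\<phi> ` U) \<and> homeomorphism U (\<phi> ` U) \<phi> (inv_into U \<phi>)) \<and>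
     (\<forall>(U, \<phi>)\<in>A. \<forall>(V, \<psi>)\<in>A. C (\<phi> ` (U \<inter> V)) (\<psi> \<circ> inv_into U \<phi>))"

definition smooth_manifold ::
    "('a::{t2_space, second_countable_topology}, 'e::real_normed_vector) chart set \<Rightarrow> bool" where
  "smooth_manifold = manifold_atlas smooth_on"

definition complex_manifold ::
    "('a::{t2_space, second_countable_topology}, 'e::complex_normed_vector) chart set \<Rightarrow> bool" where
  "complex_manifold = manifold_atlas holo_on"

definition prod_atlas ::
    "('a, 'e) chart set \<Rightarrow> ('b, 'f) chart set \<Rightarrow> ('a \<times> 'b, 'e \<times> 'f) chart set" where
  "prod_atlas A B = {(U \<times> V, map_prod \<phi> \<psi>) | U \<phi> V \<psi>. (U, \<phi>) \<in> A \<and> (V, \<psi>) \<in> B}"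

definition holomorphic_fun_on ::
    "('a, 'e::complex_normed_vector) chart set \<Rightarrow> 'a set \<Rightarrow> ('a \<Rightarrow> complex) \<Rightarrow> bool" where
  "holomorphic_fun_on A W g \<longleftrightarrow> (\<forall>(U, \<phi>)\<in>A. holo_on (\<phi> ` (U \<inter> W)) (g \<circ> inv_into U \<phi>))"

definition lie_group ::
    "'h monoid \<Rightarrow>
     ('h::{t2_space, second_countable_topology}, 'm::real_normed_vector) chart set \<Rightarrow> bool" where
  "lie_group G A \<longleftrightarrow> group G \<and> carrier G = UNIV \<and> smooth_manifold A \<and>
     smooth_map (prod_atlas A A) A (\<lambda>(g, h). g \<otimes>\<^bsub>G\<^esub> h) \<and>
     smooth_map A A (\<lambda>g. inv\<^bsub>G\<^esub> g)"

section \<open>Holomorphic line bundles\<close>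

text \<open>\<open>fadd\<close> and \<open>fscale\<close> are the vector space operations of the fibres. A local trivialization
  over \<open>U\<close> is given by its fibre coordinate \<open>\<tau>\<close>, so that \<open>v \<mapsto> (proj v, \<tau> v)\<close> identifies the
  part of the bundle over \<open>U\<close> with \<open>U \<times> \<complex>\<close>.\<close>

record ('l, 'd) line_bundle =
  total :: "'l set"
  proj :: "'l \<Rightarrow> 'd"
  fadd :: "'l \<Rightarrow> 'l \<Rightarrow> 'l"
  fscale :: "complex \<Rightarrow> 'l \<Rightarrow> 'l"
  trivs :: "('d set \<times> ('l \<Rightarrow> complex)) set"

text \<open>The trivializations are linear and bijective on fibres; this makes every fibre a
  one-dimensional complex vector space. The topology and the complex structure of the total space
  are those given by \<open>total_atlas\<close>.\<close>

definition holomorphic_line_bundle ::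
    "('d::topological_space, 'e::complex_normed_vector) chart set \<Rightarrow>
     ('l, 'd) line_bundle \<Rightarrow> bool" where
  "holomorphic_line_bundle A L \<longleftrightarrow>
     (\<forall>v\<in>total L. \<forall>w\<in>total L. proj L v = proj L w \<longrightarrow>
        fadd L v w \<in> total L \<and> proj L (fadd L v w) = proj L v) \<and>
     (\<forall>v\<in>total L. \<forall>c. fscale L c v \<in> total L \<and> proj L (fscale L c v) = proj L v) \<and>
     \<Union>(fst ` trivs L) = UNIV \<and>
     (\<forall>(U, \<tau>)\<in>trivs L. open U \<and>
        bij_betw (\<lambda>v. (proj L v, \<tau> v)) {v \<in> total L. proj L v \<in> U} (U \<times> UNIV) \<and>
        (\<forall>v\<in>total L. \<forall>w\<in>total L. proj L v \<in> U \<and> proj L v = proj L w \<longrightarrow>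
           \<tau> (fadd L v w) = \<tau> v + \<tau> w) \<and>
        (\<forall>v\<in>total L. \<forall>c. proj L v \<in> U \<longrightarrow> \<tau> (fscale L c v) = c * \<tau> v)) \<and>
     (\<forall>(U, \<tau>)\<in>trivs L. \<forall>(V, \<rho>)\<in>trivs L. \<exists>g.
        holomorphic_fun_on A (U \<inter> V) g \<and> (\<forall>x\<in>U \<inter> V. g x \<noteq> 0) \<and>
        (\<forall>v\<in>total L. proj L v \<in> U \<inter> V \<longrightarrow> \<rho> v = g (proj L v) * \<tau> v))"

definition total_atlas ::
    "('d, 'e) chart set \<Rightarrow> ('l, 'd) line_bundle \<Rightarrow> ('l, 'e \<times> complex) chart set" where
  "total_atlas A L =
     {({v \<in> total L. proj L v \<in> W \<inter> U}, \<lambda>v. (\<phi> (proj L v), \<tau> v)) | W \<phi> U \<tau>.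
        (W, \<phi>) \<in> A \<and> (U, \<tau>) \<in> trivs L}"

definition fibrewise_linear ::
    "('l, 'd) line_bundle \<Rightarrow> ('k, 'd) line_bundle \<Rightarrow> ('l \<Rightarrow> 'k) \<Rightarrow> bool" where
  "fibrewise_linear L M F \<longleftrightarrow>
     (\<forall>v\<in>total L. \<forall>w\<in>total L. proj L v = proj L w \<longrightarrow> F (fadd L v w) = fadd M (F v) (F w)) \<and>
     (\<forall>v\<in>total L. \<forall>c. F (fscale L c v) = fscale M c (F v))"

definition line_bundle_iso ::
    "('d::topological_space, 'e::complex_normed_vector) chart set \<Rightarrow>
     ('l, 'd) line_bundle \<Rightarrow> ('k, 'd) line_bundle \<Rightarrow> ('l \<Rightarrow> 'k) \<Rightarrow> bool" where
  "line_bundle_iso A L M \<Psi> \<longleftrightarrow>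
     bij_betw \<Psi> (total L) (total M) \<and> (\<forall>v\<in>total L. proj M (\<Psi> v) = proj L v) \<and>
     fibrewise_linear L M \<Psi> \<and>
     holomorphic_map (total_atlas A L) (total_atlas A M) \<Psi> \<and>
     holomorphic_map (total_atlas A M) (total_atlas A L) (inv_into (total L) \<Psi>)"

definition pullback_bundle ::
    "('d \<Rightarrow> 'd) \<Rightarrow> ('l, 'd) line_bundle \<Rightarrow> ('d \<times> 'l, 'd) line_bundle" where
  "pullback_bundle \<sigma> L = \<lparr>
     total = {(x, v). v \<in> total L \<and> \<sigma> x = proj L v},
     proj = fst,
     fadd = (\<lambda>(x, v) (y, w). (x, fadd L v w)),
     fscale = (\<lambda>c (x, v). (x, fscale L c v)),
     trivs = {(\<sigma> -` U, \<lambda>(x, v). \<tau> v) | U \<tau>. (U, \<tau>) \<in> trivs L}\<rparr>"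

text \<open>Conjugating the fibre coordinates conjugates the transition functions; they are linear for
  the conjugate scalar multiplication.\<close>

definition conj_bundle :: "('l, 'd) line_bundle \<Rightarrow> ('l, 'd) line_bundle" where
  "conj_bundle L = \<lparr>
     total = total L,
     proj = proj L,
     fadd = fadd L,
     fscale = (\<lambda>c v. fscale L (cnj c) v),
     trivs = {(U, \<lambda>v. cnj (\<tau> v)) | U \<tau>. (U, \<tau>) \<in> trivs L}\<rparr>"

section \<open>Equivariant line bundles\<close>

definition holomorphic_action ::
    "'h monoid \<Rightarrow> ('h, 'm::real_normed_vector) chart set \<Rightarrow>
     ('d, 'e::complex_normed_vector) chart set \<Rightarrow> ('h \<Rightarrow> 'd \<Rightarrow> 'd) \<Rightarrow> bool" where
  "holomorphic_action G AG A act \<longleftrightarrow>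
     group_action G (\<Union>(fst ` A)) act \<and>
     smooth_map (prod_atlas AG A) A (\<lambda>(h, x). act h x) \<and>
     (\<forall>h\<in>carrier G. holomorphic_map A A (act h))"

definition equivariant_line_bundle ::
    "'h monoid \<Rightarrow> ('h, 'm::real_normed_vector) chart set \<Rightarrow>
     ('d::topological_space, 'e::complex_normed_vector) chart set \<Rightarrow> ('h \<Rightarrow> 'd \<Rightarrow> 'd) \<Rightarrow>
     ('l, 'd) line_bundle \<Rightarrow> ('h \<Rightarrow> 'l \<Rightarrow> 'l) \<Rightarrow> bool" where
  "equivariant_line_bundle G AG A act L actL \<longleftrightarrow>
     holomorphic_line_bundle A L \<and>
     holomorphic_action G AG A act \<and>
     holomorphic_action G AG (total_atlas A L) actL \<and>
     (\<forall>h\<in>carrier G. \<forall>v\<in>total L. proj L (actL h v) = act h (proj L v)) \<and>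
     (\<forall>h\<in>carrier G. fibrewise_linear L L (actL h))"

definition equivariant_line_bundle_iso ::
    "'h monoid \<Rightarrow> ('h, 'm::real_normed_vector) chart set \<Rightarrow>
     ('d::topological_space, 'e::complex_normed_vector) chart set \<Rightarrow> ('h \<Rightarrow> 'd \<Rightarrow> 'd) \<Rightarrow>
     ('l, 'd) line_bundle \<Rightarrow> ('h \<Rightarrow> 'l \<Rightarrow> 'l) \<Rightarrow>
     ('k, 'd) line_bundle \<Rightarrow> ('h \<Rightarrow> 'k \<Rightarrow> 'k) \<Rightarrow> ('l \<Rightarrow> 'k) \<Rightarrow> bool" where
  "equivariant_line_bundle_iso G AG A act L actL M actM \<Psi> \<longleftrightarrow>
     equivariant_line_bundle G AG A act L actL \<and>
     equivariant_line_bundle G AG A act M actM \<and>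
     line_bundle_iso A L M \<Psi> \<and>
     (\<forall>h\<in>carrier G. \<forall>v\<in>total L. \<Psi> (actL h v) = actM h (\<Psi> v))"

text \<open>The action of the group on the total space of the pull-back along \<open>\<sigma>\<close> (and of its
  conjugate). It is well defined if \<open>\<sigma> (act h x) = act (\<theta> h) (\<sigma> x)\<close> for an automorphism \<open>\<theta>\<close>
  of the group; \<open>\<theta> = id\<close> is the case where \<open>\<sigma>\<close> commutes with the action. The restriction to the total space is
  needed because \<^const>\<open>group_action\<close> consists of extensional functions.\<close>

definition pullback_action ::
    "('d \<Rightarrow> 'd) \<Rightarrow> ('h \<Rightarrow> 'h) \<Rightarrow> ('h \<Rightarrow> 'd \<Rightarrow> 'd) \<Rightarrow> ('l, 'd) line_bundle \<Rightarrow> ('h \<Rightarrow> 'l \<Rightarrow> 'l) \<Rightarrow>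
     'h \<Rightarrow> 'd \<times> 'l \<Rightarrow> 'd \<times> 'l" where
  "pullback_action \<sigma> \<theta> act L actL h =
     restrict (\<lambda>(x, v). (act h x, actL (\<theta> h) v)) (total (pullback_bundle \<sigma> L))"

section \<open>Holomorphic sections\<close>

definition holomorphic_sections ::
    "('d, 'e::complex_normed_vector) chart set \<Rightarrow> ('l, 'd) line_bundle \<Rightarrow> ('d \<Rightarrow> 'l) set" where
  "holomorphic_sections A L =
     {s. (\<forall>x. s x \<in> total L \<and> proj L (s x) = x) \<and> holomorphic_map A (total_atlas A L) s}"

text \<open>Uniform convergence on compact sets. It suffices to consider compact sets inside the domain
  of a trivialization, since every compact set is a finite union of such sets.\<close>

definition section_topology ::
    "('d::topological_space, 'e::complex_normed_vector) chart set \<Rightarrow> ('l, 'd) line_bundle \<Rightarrow>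
     ('d \<Rightarrow> 'l) topology" where
  "section_topology A L = topology_generated_by
     {{t \<in> holomorphic_sections A L. \<forall>x\<in>K. cmod (\<tau> (t x) - \<tau> (s x)) < \<epsilon>} | U \<tau> K s \<epsilon>.
        (U, \<tau>) \<in> trivs L \<and> compact K \<and> K \<subseteq> U \<and> s \<in> holomorphic_sections A L \<and> \<epsilon> > 0}"

definition section_action ::
    "'h monoid \<Rightarrow> ('h \<Rightarrow> 'd \<Rightarrow> 'd) \<Rightarrow> ('h \<Rightarrow> 'l \<Rightarrow> 'l) \<Rightarrow> 'h \<Rightarrow> ('d \<Rightarrow> 'l) \<Rightarrow> 'd \<Rightarrow> 'l" where
  "section_action G act actL h s = (\<lambda>x. actL h (s (act (inv\<^bsub>G\<^esub> h) x)))"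

section \<open>Unitary representations and intertwining operators\<close>

definition unitary_representation ::
    "'h::topological_space monoid \<Rightarrow> ('h \<Rightarrow> 'v::chilbert_space \<Rightarrow> 'v) \<Rightarrow> bool" where
  "unitary_representation G \<pi> \<longleftrightarrow>
     (\<forall>g\<in>carrier G. \<forall>h\<in>carrier G. \<pi> (g \<otimes>\<^bsub>G\<^esub> h) = \<pi> g \<circ> \<pi> h) \<and> \<pi> \<one>\<^bsub>G\<^esub> = id \<and>
     (\<forall>g\<in>carrier G. (\<forall>u v. \<pi> g (u + v) = \<pi> g u + \<pi> g v) \<and> (\<forall>c v. \<pi> g (c *\<^sub>C v) = c *\<^sub>C \<pi> g v) \<and>
        (\<forall>u v. cinner (\<pi> g u) (\<pi> g v) = cinner u v)) \<and>
     (\<forall>v. continuous_on (carrier G) (\<lambda>g. \<pi> g v))"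

definition intertwining_embedding ::
    "'h monoid \<Rightarrow> ('h \<Rightarrow> 'v::chilbert_space \<Rightarrow> 'v) \<Rightarrow>
     ('d::topological_space, 'e::complex_normed_vector) chart set \<Rightarrow> ('h \<Rightarrow> 'd \<Rightarrow> 'd) \<Rightarrow>
     ('l, 'd) line_bundle \<Rightarrow> ('h \<Rightarrow> 'l \<Rightarrow> 'l) \<Rightarrow> ('v \<Rightarrow> 'd \<Rightarrow> 'l) \<Rightarrow> bool" where
  "intertwining_embedding G \<pi> A act L actL T \<longleftrightarrow>
     range T \<subseteq> holomorphic_sections A L \<and>
     (\<forall>u v x. T (u + v) x = fadd L (T u x) (T v x)) \<and>
     (\<forall>c v x. T (c *\<^sub>C v) x = fscale L c (T v x)) \<and>
     inj T \<and>
     continuous_map euclidean (section_topology A L) T \<and>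
     (\<forall>h\<in>carrier G. \<forall>v. T (\<pi> h v) = section_action G act actL h (T v))"

definition intertwiner_ring ::
    "'h monoid \<Rightarrow> ('h \<Rightarrow> 'v::chilbert_space \<Rightarrow> 'v) \<Rightarrow> ('v \<Rightarrow> 'v) ring" where
  "intertwiner_ring G \<pi> = \<lparr>
     carrier = {A. bounded_linear A \<and> (\<forall>c v. A (c *\<^sub>C v) = c *\<^sub>C A v) \<and>
                   (\<forall>h\<in>carrier G. A \<circ> \<pi> h = \<pi> h \<circ> A)},
     mult = (\<circ>), one = id, ring.zero = (\<lambda>v. 0), add = (\<lambda>A B v. A v + B v)\<rparr>"

lemma ring_intertwiner_ring:
  assumes "unitary_representation G \<pi>"
  shows "ring (intertwiner_ring G \<pi>)"
proof -
  let ?R = "intertwiner_ring G \<pi>"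
  have add: "\<pi> h (u + v) = \<pi> h u + \<pi> h v" if "h \<in> carrier G" for h u v
    using assms that by (auto simp: unitary_representation_def)
  have zero: "\<pi> h 0 = 0" if "h \<in> carrier G" for h
    using add[OF that, of 0 0] by simp
  have minus: "\<pi> h (- v) = - \<pi> h v" if "h \<in> carrier G" for h v
    using add[OF that, of v "- v"] zero[OF that] by (simp add: eq_neg_iff_add_eq_0 add.commute)
  have cz: "c *\<^sub>C (0::'b) = 0" for c
    using scaleC_add_right[of c "0::'b" 0] by simp
  have cm: "c *\<^sub>C (- v) = - (c *\<^sub>C v)" for c and v :: 'b
    using scaleC_add_right[of c v "- v"] cz[of c] by (simp add: eq_neg_iff_add_eq_0 add.commute)
  have "abelian_group ?R"
  proof (rule abelian_groupI)
    fix A assume A: "A \<in> carrier ?R"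
    then have "(\<lambda>v. - A v) \<in> carrier ?R"
      by (auto simp: intertwiner_ring_def fun_eq_iff minus cm intro: bounded_linear_minus)
    then show "\<exists>B\<in>carrier ?R. B \<oplus>\<^bsub>?R\<^esub> A = \<zero>\<^bsub>?R\<^esub>"
      by (auto simp: intertwiner_ring_def fun_eq_iff)
  qed (auto simp: intertwiner_ring_def fun_eq_iff add zero cz scaleC_add_right algebra_simps
        intro: bounded_linear_add)
  moreover have "Group.monoid ?R"
    by (rule monoidI) (auto simp: intertwiner_ring_def fun_eq_iff
        intro: bounded_linear_compose[unfolded o_def[symmetric]] bounded_linear_ident[folded id_def])
  ultimately show ?thesis
    by (rule ringI) (auto simp: intertwiner_ring_def fun_eq_iff linear_add bounded_linear.linear)
qed

definition multiplicity_free :: "'h monoid \<Rightarrow> ('h \<Rightarrow> 'v::chilbert_space \<Rightarrow> 'v) \<Rightarrow> bool" where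
  "multiplicity_free G \<pi> \<longleftrightarrow> cring (intertwiner_ring G \<pi>)"

end

theory Submission
  imports Defs "HOL-Complex_Analysis.Complex_Analysis"
begin

text \<open>In local coordinates, evaluation of \<open>T v\<close> at \<open>z\<close> and at \<open>\<sigma> z\<close> is given by vectors \<open>K z\<close> and
  \<open>K' z\<close>, which are antiholomorphic and holomorphic in \<open>z\<close>. Since \<open>\<sigma> z = g \<cdot> z\<close> for some \<open>g\<close>,
  \<open>K' z\<close> is a multiple of \<open>\<pi>(g) K z\<close>, so that \<open>\<langle>B K' z, K' z\<rangle>\<close> is a multiple of \<open>\<langle>B K z, K z\<rangle>\<close>
  which does not depend on the intertwining operator \<open>B\<close>. The isomorphism \<open>\<Psi>\<close> identifies this
  multiple as the absolute value of a nonvanishing holomorphic function, hence locally as \<open>\<bar>r\<bar>\<^sup>2\<close>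
  with \<open>r\<close> holomorphic. Polarization gives \<open>\<langle>B E z, E w\<rangle> = \<langle>B K w, K z\<rangle>\<close> for \<open>E = K' / r\<close>,
  so \<open>K z \<mapsto> E z\<close> extends to an antiunitary operator \<open>J\<close> with \<open>B J = J B\<^sup>*\<close>. Conjugation
  by \<open>J\<close> being multiplicative and \<open>B \<mapsto> B\<^sup>*\<close> antimultiplicative, intertwining operators commute.\<close>

section \<open>Hilbert spaces\<close>

text \<open>Condition (c) yields some g for each z, with no control on how g varies, so the factor
  between K' z and \<pi>(g)(K z) is an arbitrary function of z. On the diagonal only its modulus
  matters, and that modulus can be computed. Let c be the factor of g from the fibre over x to that
  over \<sigma> x, and d that of \<theta>(g) on the way back. Unitarity in both directions gives |c
  d| = 1 when K z is nonzero. With p and q' the factors of \<Psi> over x and over \<sigma> x,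
  equivariance of \<Psi> reads q' c = cnj d p. Together, |c|^2 = |p / q'|, which involves neither g
  nor B.

  The argument can stay near one point because sections over a connected base are determined by
  their values on any nonempty open set. Polarization is a one-variable matter as well: z and w are
  joined by a complex line.\<close>

lemma cinner_add_right: "cinner x (y + z) = cinner x y + cinner x z"
  by (metis cinner_add_left cinner_commute complex_cnj_add)

lemma cinner_scaleC_right: "cinner x (c *\<^sub>C y) = cnj c * cinner x y"
  by (metis cinner_scaleC_left cinner_commute complex_cnj_mult)

lemma cinner_zero_left [simp]: "cinner 0 x = 0"
  using cinner_add_left[of 0 0 x] by simp

lemma cinner_zero_right [simp]: "cinner x 0 = 0"
  using cinner_add_right[of x 0 0] by simp

lemma cinner_minus_left: "cinner (- x) y = - cinner x y"
  using cinner_add_left[of x "- x" y] by (simp add: eq_neg_iff_add_eq_0 add.commute)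

lemma cinner_minus_right: "cinner x (- y) = - cinner x y"
  using cinner_add_right[of x y "- y"] by (simp add: eq_neg_iff_add_eq_0 add.commute)

lemma cinner_diff_left: "cinner (x - y) z = cinner x z - cinner y z"
  using cinner_add_left[of x "- y" z] by (simp add: cinner_minus_left)

lemma cinner_diff_right: "cinner x (y - z) = cinner x y - cinner x z"
  using cinner_add_right[of x y "- z"] by (simp add: cinner_minus_right)

lemma cinner_scaleR_left: "cinner (r *\<^sub>R x) y = r *\<^sub>R cinner x y"
  using cinner_scaleC_left[of "complex_of_real r" x y] by (simp add: scaleC_of_real scaleR_conv_of_real)

lemma cinner_scaleR_right: "cinner x (r *\<^sub>R y) = r *\<^sub>R cinner x y"
  using cinner_scaleC_right[of x "complex_of_real r" y] by (simp add: scaleC_of_real scaleR_conv_of_real)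

lemma scaleC_zero_right [simp]: "c *\<^sub>C (0::'a::complex_normed_vector) = 0"
  using scaleC_add_right[of c "0::'a" 0] by simp

lemma scaleC_one [simp]: "1 *\<^sub>C (x::'a::complex_normed_vector) = x"
  using scaleC_of_real[of 1 x] by simp

lemma bounded_linear_scaleC_left: "bounded_linear (\<lambda>c. c *\<^sub>C (x::'a::complex_normed_vector))"
  by (rule bounded_linear_intro[of _ "norm x"])
    (simp_all add: scaleC_add_left norm_scaleC scaleR_conv_of_real flip: scaleC_of_real scaleC_scaleC)

lemma power2_norm_eq_cinner: "(norm x)\<^sup>2 = Re (cinner x x)"
  by (simp add: cinner_self)

text \<open>The Cauchy-Schwarz inequality and the orthogonality of the projection both come from
  inserting the minimizing \<open>c\<close>, complex in the first case and real in the
  second.\<close>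

lemma norm_sub_scaleC_square:
  "(norm (x - c *\<^sub>C y))\<^sup>2 = (norm x)\<^sup>2 - 2 * Re (cnj c * cinner x y) + (cmod c)\<^sup>2 * (norm y)\<^sup>2"
proof -
  have "cinner (x - c *\<^sub>C y) (x - c *\<^sub>C y)
      = cinner x x - (cnj c * cinner x y + cnj (cnj c * cinner x y)) + c * cnj c * cinner y y"
    by (simp add: cinner_diff_left cinner_diff_right cinner_scaleC_left cinner_scaleC_right
        cinner_commute[of y x] algebra_simps)
  then show ?thesis
    by (simp add: power2_norm_eq_cinner complex_add_cnj complex_norm_square[symmetric] del: of_real_power)
qed

lemma norm_cinner_le: "cmod (cinner x y) \<le> norm x * norm y"
proof (cases "y = 0")
  case False
  define c where "c = cinner x y / complex_of_real ((norm y)\<^sup>2)"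
  have n: "(norm y)\<^sup>2 > 0" using False by simp
  have "cnj c * cinner x y = complex_of_real ((cmod (cinner x y))\<^sup>2 / (norm y)\<^sup>2)"
    unfolding of_real_divide complex_norm_square by (simp add: c_def mult.commute)
  then have "Re (cnj c * cinner x y) = (cmod (cinner x y))\<^sup>2 / (norm y)\<^sup>2" by simp
  moreover have "(cmod c)\<^sup>2 * (norm y)\<^sup>2 = (cmod (cinner x y))\<^sup>2 / (norm y)\<^sup>2"
    using n by (simp add: c_def norm_divide power_divide power2_eq_square norm_mult)
  ultimately have "0 \<le> (norm x)\<^sup>2 - (cmod (cinner x y))\<^sup>2 / (norm y)\<^sup>2"
    using norm_sub_scaleC_square[of x c y] by (smt (verit) zero_le_power2)
  then have "(cmod (cinner x y))\<^sup>2 \<le> (norm x * norm y)\<^sup>2"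
    using n by (simp add: power_mult_distrib field_simps)
  then show ?thesis by (rule power2_le_imp_le) simp
qed simp

lemma bounded_bilinear_cinner: "bounded_bilinear (cinner :: 'a::chilbert_space \<Rightarrow> _)"
proof
  show "\<exists>K. \<forall>a b::'a. norm (cinner a b) \<le> norm a * norm b * K"
    by (rule exI[of _ 1]) (simp add: norm_cinner_le)
qed (simp_all add: cinner_add_left cinner_add_right cinner_scaleR_left cinner_scaleR_right)

lemmas tendsto_cinner = bounded_bilinear.tendsto[OF bounded_bilinear_cinner]
lemmas bounded_linear_cinner_left = bounded_bilinear.bounded_linear_left[OF bounded_bilinear_cinner]

section \<open>Orthogonal projection and Riesz representation\<close>

lemma parallelogram:
  "(norm (x + y))\<^sup>2 + (norm (x - y))\<^sup>2 = 2 * (norm x)\<^sup>2 + 2 * (norm (y::'a::chilbert_space))\<^sup>2"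
  by (simp add: power2_norm_eq_cinner cinner_add_left cinner_add_right cinner_diff_left cinner_diff_right)

lemma subspace_closure:
  fixes S :: "'a::real_normed_vector set"
  assumes S: "subspace S"
  shows "subspace (closure S)"
proof (rule subspaceI)
  show "0 \<in> closure S" using S closure_subset subspace_0 by blast
next
  fix x y assume "x \<in> closure S" "y \<in> closure S"
  then obtain f g where "\<And>n. f n \<in> S" "f \<longlonglongrightarrow> x" "\<And>n. g n \<in> S" "g \<longlonglongrightarrow> y"
    unfolding closure_sequential by blast
  then have "(\<lambda>n. f n + g n) \<longlonglongrightarrow> x + y" "\<And>n. f n + g n \<in> S"
    using S by (auto intro: tendsto_add subspace_add)
  then show "x + y \<in> closure S"
    unfolding closure_sequential by (intro exI[of _ "\<lambda>n. f n + g n"]) simp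
next
  fix c x assume "x \<in> closure S"
  then obtain f where "\<And>n. f n \<in> S" "f \<longlonglongrightarrow> x"
    unfolding closure_sequential by blast
  then have "(\<lambda>n. c *\<^sub>R f n) \<longlonglongrightarrow> c *\<^sub>R x" "\<And>n. c *\<^sub>R f n \<in> S"
    using S by (auto intro: tendsto_scaleR tendsto_const subspace_scale)
  then show "c *\<^sub>R x \<in> closure S"
    unfolding closure_sequential by (intro exI[of _ "\<lambda>n. c *\<^sub>R f n"]) simp
qed

text \<open>A minimizing sequence is Cauchy because midpoints stay in \<open>M\<close>. As
  \<open>subspace\<close> means real subspace, the remainder is orthogonal for the real inner
  product only; \<open>cinner_eq_0_if_Re\<close> recovers the complex statement where multiples by
  \<i> are available.\<close>

lemma orthogonal_projection:
  fixes x :: "'a::chilbert_space"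
  assumes M: "subspace M" "closed M"
  shows "\<exists>m\<in>M. \<forall>y\<in>M. Re (cinner (x - m) y) = 0"
proof -
  define d where "d = (INF y\<in>M. (norm (x - y))\<^sup>2)"
  have ne: "M \<noteq> {}" using M(1) subspace_0 by blast
  have bdd: "bdd_below ((\<lambda>y. (norm (x - y))\<^sup>2) ` M)" by (rule bdd_belowI[of _ 0]) auto
  have d_le: "d \<le> (norm (x - y))\<^sup>2" if "y \<in> M" for y
    unfolding d_def using bdd that by (rule cINF_lower)
  have "\<exists>y\<in>M. (norm (x - y))\<^sup>2 < d + 1 / real (Suc n)" for n
    using cINF_less_iff[OF ne bdd, of "d + 1 / real (Suc n)"] by (simp add: d_def)
  then obtain s where s: "\<And>n. s n \<in> M" "\<And>n. (norm (x - s n))\<^sup>2 < d + 1 / real (Suc n)"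
    by metis
  \<comment> \<open>Parallelogram law for \<open>x - s m\<close> and \<open>x - s n\<close>: half
    their sum is \<open>x\<close> minus the midpoint, whose squared norm is at least
    \<open>d\<close>.\<close>
  have close: "(norm (s m - s n))\<^sup>2 \<le> 2 / real (Suc m) + 2 / real (Suc n)" for m n
  proof -
    have mid: "(1/2) *\<^sub>R (s m + s n) \<in> M"
      using s(1) M(1) by (intro subspace_scale subspace_add)
    have "(x - s m) + (x - s n) = 2 *\<^sub>R (x - (1/2) *\<^sub>R (s m + s n))"
      by (simp add: algebra_simps scaleR_2)
    then have "(norm ((x - s m) + (x - s n)))\<^sup>2 = 4 * (norm (x - (1/2) *\<^sub>R (s m + s n)))\<^sup>2"
      by (simp only: norm_scaleR power_mult_distrib) simp
    moreover have "norm ((x - s m) - (x - s n)) = norm (s m - s n)"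
      by (simp add: norm_minus_commute)
    ultimately show ?thesis
      using parallelogram[of "x - s m" "x - s n"] d_le[OF mid] s(2)[of m] s(2)[of n] by simp
  qed
  have "Cauchy s"
  proof (rule metric_CauchyI)
    fix e :: real assume "e > 0"
    \<comment> \<open>Makes each of the two summands in \<open>close\<close> smaller than half the
      square of \<open>e\<close>.\<close>
    then obtain N where N: "4 / e\<^sup>2 < real N" using reals_Archimedean2 by blast
    have "dist (s m) (s n) < e" if "m \<ge> N" "n \<ge> N" for m n
    proof -
      have "4 / e\<^sup>2 < real (Suc m)" "4 / e\<^sup>2 < real (Suc n)" using N that by linarith+
      then have "2 / real (Suc m) < e\<^sup>2 / 2" "2 / real (Suc n) < e\<^sup>2 / 2"
        using \<open>e > 0\<close> by (simp_all add: field_simps)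
      then have "(norm (s m - s n))\<^sup>2 < e\<^sup>2" using close[of m n] by linarith
      then show ?thesis using \<open>e > 0\<close> by (simp add: dist_norm power2_less_imp_less)
    qed
    then show "\<exists>N. \<forall>m\<ge>N. \<forall>n\<ge>N. dist (s m) (s n) < e" by blast
  qed
  then obtain m where m: "s \<longlonglongrightarrow> m" using Cauchy_convergent convergent_def by blast
  have mM: "m \<in> M" using closed_sequentially[OF M(2) _ m] s(1) by blast
  have "(norm (x - m))\<^sup>2 \<le> d + 0"
  proof (rule LIMSEQ_le)
    show "(\<lambda>n. (norm (x - s n))\<^sup>2) \<longlonglongrightarrow> (norm (x - m))\<^sup>2" by (intro tendsto_intros m)
    show "(\<lambda>n. d + 1 / real (Suc n)) \<longlonglongrightarrow> d + 0"
      by (intro tendsto_intros LIMSEQ_Suc[OF lim_1_over_n])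
  qed (use s(2) less_imp_le in blast)
  then have min: "(norm (x - m))\<^sup>2 \<le> d" by simp
  have "Re (cinner (x - m) y) = 0" if y: "y \<in> M" for y
  proof (cases "y = 0")
    case False
    \<comment> \<open>The real coefficient minimizing the distance from \<open>x - m\<close> to the
      line through \<open>y\<close>; were it nonzero, \<open>m + t *\<^sub>R y\<close> would be
      closer to \<open>x\<close> than \<open>m\<close> is.\<close>
    define t where "t = Re (cinner (x - m) y) / (norm y)\<^sup>2"
    have "m + t *\<^sub>R y \<in> M" using mM y M(1) by (intro subspace_scale subspace_add)
    then have "(norm (x - m))\<^sup>2 \<le> (norm (x - (m + t *\<^sub>R y)))\<^sup>2" using min d_le order_trans by blast
    also have "x - (m + t *\<^sub>R y) = (x - m) - complex_of_real t *\<^sub>C y"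
      by (simp add: scaleC_of_real)
    also have "(norm \<dots>)\<^sup>2 = (norm (x - m))\<^sup>2 - (Re (cinner (x - m) y))\<^sup>2 / (norm y)\<^sup>2"
      unfolding norm_sub_scaleC_square using False
      by (simp add: t_def power2_eq_square norm_divide norm_mult)
    finally have "(Re (cinner (x - m) y))\<^sup>2 \<le> 0" using False by (simp add: field_simps)
    then show ?thesis by simp
  qed simp
  with mM show ?thesis by blast
qed

lemma cinner_eq_0_if_Re:
  assumes "\<And>c. Re (cinner x (c *\<^sub>C y)) = 0"
  shows "cinner x y = 0"
proof -
  have "Re (cinner x y) = 0" using assms[of 1] by simp
  moreover have "Im (cinner x y) = 0" using assms[of \<i>] by (simp add: cinner_scaleC_right)
  ultimately show ?thesis by (simp add: complex_eq_iff)
qed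

text \<open>What the projection onto \<open>M\<close> leaves of a vector is orthogonal to every
  \<open>K z\<close>, hence zero. The complex multiples in the hypothesis compensate for
  \<open>M\<close> being a real subspace. This serves for the density of spans and, with
  \<open>M\<close> the set where two continuous linear maps agree, for extending identities from the
  vectors \<open>K z\<close>.\<close>

lemma closed_subspace_UNIV:
  fixes K :: "'z \<Rightarrow> 'a::chilbert_space"
  assumes M: "subspace M" "closed M"
    and K: "\<And>z c. z \<in> S \<Longrightarrow> c *\<^sub>C K z \<in> M"
    and total: "\<And>v. (\<And>z. z \<in> S \<Longrightarrow> cinner v (K z) = 0) \<Longrightarrow> v = 0"
  shows "M = UNIV"
proof -
  have "x \<in> M" for x
  proof -
    obtain m where m: "m \<in> M" "\<And>y. y \<in> M \<Longrightarrow> Re (cinner (x - m) y) = 0"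
      using orthogonal_projection[OF M] by blast
    have "x - m = 0" using m(2) K by (intro total cinner_eq_0_if_Re) blast
    then show ?thesis using m(1) by simp
  qed
  then show ?thesis by blast
qed

lemma riesz_representation:
  fixes f :: "'a::chilbert_space \<Rightarrow> complex"
  assumes f: "bounded_linear f" "\<And>c v. f (c *\<^sub>C v) = c * f v"
  shows "\<exists>k. \<forall>v. f v = cinner v k"
proof (cases "\<forall>v. f v = 0")
  case True
  then show ?thesis by (intro exI[of _ 0]) simp
next
  case False
  then obtain x where x: "f x \<noteq> 0" by blast
  interpret f: bounded_linear f by fact
  let ?M = "{v. f v = 0}"
  have "subspace ?M" by (auto simp: subspace_def f.add f.scaleR f.zero)
  moreover have "closed ?M" by (intro closed_Collect_eq f.continuous_on continuous_intros)
  ultimately obtain m where m: "f m = 0" "\<And>y. f y = 0 \<Longrightarrow> Re (cinner (x - m) y) = 0"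
    using orthogonal_projection[of ?M x] by blast
  define n where "n = x - m"
  have fn: "f n \<noteq> 0" using x m by (simp add: n_def f.diff)
  then have n: "n \<noteq> 0" using f.zero by blast
  have ort: "cinner n y = 0" if "f y = 0" for y
    by (rule cinner_eq_0_if_Re) (simp add: n_def m f that)
  have "f v = cinner v ((cnj (f n) / complex_of_real ((norm n)\<^sup>2)) *\<^sub>C n)" for v
  proof -
    \<comment> \<open>The vector \<open>f v *\<^sub>C n - f n *\<^sub>C v\<close> lies in the kernel
      of \<open>f\<close>, to which \<open>n\<close> is normal; solving for \<open>f v\<close> gives
      the representing vector.\<close>
    have "cinner n (f v *\<^sub>C n - f n *\<^sub>C v) = 0"
      by (rule ort) (simp add: f.diff f(2))
    then have "cnj (f v) * cinner n n = cnj (f n) * cinner n v"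
      by (simp add: cinner_diff_right cinner_scaleC_right)
    then have "f v * cnj (cinner n n) = f n * cinner v n"
      by (metis cinner_commute complex_cnj_cnj complex_cnj_mult)
    then have "f v * complex_of_real ((norm n)\<^sup>2) = f n * cinner v n"
      by (simp add: cinner_self)
    then show ?thesis using n by (simp add: cinner_scaleC_right field_simps)
  qed
  then show ?thesis by blast
qed

text \<open>In the proof, \<open>R\<close> is the graph of \<open>J\<inverse>\<close> on the span of the vectors \<open>E z\<close>, where \<open>J\<close> is the
  antilinear isometry with \<open>J (K z) = E z\<close>.\<close>

lemma commute_if_kernels_conjugate:
  fixes K E :: "'z \<Rightarrow> 'a::chilbert_space" and S :: "('a \<Rightarrow> 'a) set"
  assumes totalK: "\<And>v. (\<And>z. z \<in> D \<Longrightarrow> cinner v (K z) = 0) \<Longrightarrow> v = 0"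
    and totalE: "\<And>v. (\<And>z. z \<in> D \<Longrightarrow> cinner v (E z) = 0) \<Longrightarrow> v = 0"
    and S: "\<And>A. A \<in> S \<Longrightarrow> bounded_linear A" "\<And>A c v. A \<in> S \<Longrightarrow> A (c *\<^sub>C v) = c *\<^sub>C A v"
    and S_id: "id \<in> S" and S_comp: "\<And>A B. A \<in> S \<Longrightarrow> B \<in> S \<Longrightarrow> A \<circ> B \<in> S"
    and kernel: "\<And>A z w. A \<in> S \<Longrightarrow> z \<in> D \<Longrightarrow> w \<in> D \<Longrightarrow>
      cinner (A (E z)) (E w) = cinner (A (K w)) (K z)"
    and A: "A \<in> S" and B: "B \<in> S"
  shows "A \<circ> B = B \<circ> A"
proof -
  \<comment> \<open>\<open>span\<close> is real, so complex multiples are listed among the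
    generators; the conjugated coefficient records that J is antilinear.\<close>
  define R where "R = span {(c *\<^sub>C E z, cnj c *\<^sub>C K z) | c z. z \<in> D}"
  note lin = bounded_linear.linear[OF S(1)]
  have R1: "cinner (C (fst p)) (E w) = cinner (C (K w)) (snd p)"
    if "p \<in> R" "C \<in> S" "w \<in> D" for p C w
    using that(1) unfolding R_def
  proof (induction rule: span_induct)
    case base
    show ?case using lin[OF that(2)]
      by (auto simp: subspace_def cinner_add_left cinner_add_right cinner_scaleR_left
          cinner_scaleR_right linear_add linear_scale linear_0)
  next
    case (step x)
    then show ?case using kernel[OF that(2) _ that(3)]
      by (auto simp: S(2)[OF that(2)] cinner_scaleC_left cinner_scaleC_right)
  qed
  have R2: "cinner (fst p) (fst q) = cinner (snd q) (snd p)" if "p \<in> R" "q \<in> R" for p q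
    using that(2) unfolding R_def
  proof (induction rule: span_induct)
    case base
    show ?case
      by (auto simp: subspace_def cinner_add_left cinner_add_right cinner_scaleR_left
          cinner_scaleR_right)
  next
    case (step x)
    then show ?case using R1[OF that(1) S_id]
      by (auto simp: cinner_scaleC_left cinner_scaleC_right)
  qed
  \<comment> \<open>Hence a Cauchy sequence of first components has a Cauchy sequence of second
    components, which lets J\<inverse> pass to limits.\<close>
  have iso: "dist (fst p) (fst q) = dist (snd p) (snd q)" if "p \<in> R" "q \<in> R" for p q
  proof -
    have "(norm (fst p - fst q))\<^sup>2 = (norm (snd p - snd q))\<^sup>2"
      using R2 that by (simp add: power2_norm_eq_cinner cinner_diff_left cinner_diff_right)
    then show ?thesis by (simp add: dist_norm)
  qed
  have dense: "closure (fst ` R) = UNIV"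
  proof (rule closed_subspace_UNIV[where K = E and S = D])
    have "subspace (fst ` R)" unfolding R_def
      by (rule linear_subspace_image[OF bounded_linear.linear[OF bounded_linear_fst] subspace_span])
    then show "subspace (closure (fst ` R))" by (rule subspace_closure)
    fix z c assume "z \<in> D"
    then have "(c *\<^sub>C E z, cnj c *\<^sub>C K z) \<in> R" unfolding R_def by (intro span_base) blast
    then have "c *\<^sub>C E z \<in> fst ` R" by (metis fst_conv imageI)
    then show "c *\<^sub>C E z \<in> closure (fst ` R)" by (rule subsetD[OF closure_subset])
  next
    show "v = 0" if "\<And>z. z \<in> D \<Longrightarrow> cinner v (E z) = 0" for v by (rule totalE, rule that)
  qed simp
  have ABK: "A (B (K w)) = B (A (K w))" if w: "w \<in> D" for w
  proof -
    have "cinner (A (B (K w))) (K z) = cinner (B (A (K w))) (K z)" if z: "z \<in> D" for z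
    proof -
      \<comment> \<open>\<open>B (E z)\<close> need not lie in the span of the vectors
        \<open>E z\<close>, so J\<inverse> is applied to it through a limit: \<open>u\<close> below
        is the limit of the second components.\<close>
      obtain e where e: "\<forall>n. e n \<in> fst ` R" "e \<longlonglongrightarrow> B (E z)"
        using closure_sequential[of "B (E z)" "fst ` R"] unfolding dense by blast
      have "\<exists>q. q \<in> R \<and> e n = fst q" for n
        using e(1)[rule_format, of n] by (rule imageE) (intro exI conjI)
      then obtain p where p: "\<And>n. p n \<in> R" "\<And>n. e n = fst (p n)" by metis
      have "Cauchy (\<lambda>n. fst (p n))" using LIMSEQ_imp_Cauchy[OF e(2)] by (simp flip: p(2))
      then have "Cauchy (\<lambda>n. snd (p n))" using iso[OF p(1) p(1)] by (simp add: Cauchy_def)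
      then obtain u where u: "(\<lambda>n. snd (p n)) \<longlonglongrightarrow> u"
        using Cauchy_convergent convergent_def by blast
      have lim: "cinner (C (B (E z))) (E w) = cinner (C (K w)) u" if "C \<in> S" "w \<in> D" for C w
      proof (rule LIMSEQ_unique)
        show "(\<lambda>n. cinner (C (e n)) (E w)) \<longlonglongrightarrow> cinner (C (B (E z))) (E w)"
          by (rule tendsto_cinner[OF bounded_linear.tendsto[OF S(1)[OF that(1)] e(2)] tendsto_const])
        show "(\<lambda>n. cinner (C (e n)) (E w)) \<longlonglongrightarrow> cinner (C (K w)) u"
          using tendsto_cinner[OF tendsto_const[of "C (K w)"] u] R1[OF p(1) that] by (simp add: p(2))
      qed
      \<comment> \<open>This identifies \<open>u\<close> as the adjoint of \<open>B\<close> applied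
        to \<open>K z\<close>, without introducing adjoints: \<open>lim\<close> with
        \<open>id\<close> and \<open>kernel\<close> for \<open>B\<close> agree on the total family
        \<open>K w\<close>.\<close>
      have "{x. cinner x u = cinner (B x) (K z)} = UNIV"
      proof (rule closed_subspace_UNIV[where K = K and S = D])
        show "subspace {x. cinner x u = cinner (B x) (K z)}" using lin[OF B]
          by (auto simp: subspace_def cinner_add_left cinner_scaleR_left linear_add linear_scale linear_0)
        show "closed {x. cinner x u = cinner (B x) (K z)}"
          by (intro closed_Collect_eq bounded_linear.continuous_on[OF bounded_linear_cinner_left]
              bounded_linear.continuous_on[OF S(1)[OF B]] continuous_intros)
        fix w c assume "w \<in> D"
        then show "c *\<^sub>C K w \<in> {x. cinner x u = cinner (B x) (K z)}"
          using lim[OF S_id] kernel[OF B z, of w] by (simp add: cinner_scaleC_left S(2)[OF B])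
      next
    show "v = 0" if "\<And>z. z \<in> D \<Longrightarrow> cinner v (K z) = 0" for v by (rule totalK, rule that)
      qed
      then have "cinner (A (K w)) u = cinner (B (A (K w))) (K z)" by blast
      \<comment> \<open>The number \<open>cinner (A (B (E z))) (E w)\<close> is evaluated twice:
        \<open>lim\<close> for \<open>A\<close> yields \<open>B (A (K w))\<close>, whereas
        \<open>kernel\<close> for \<open>A \<circ> B\<close> yields
        \<open>A (B (K w))\<close>.\<close>
      then show ?thesis
        using lim[OF A w] kernel[OF S_comp[OF A B] z w] by simp
    qed
    then have "A (B (K w)) - B (A (K w)) = 0"
      by (intro totalK) (simp add: cinner_diff_left)
    then show ?thesis by simp
  qed
  have "{x. A (B x) = B (A x)} = UNIV"
  proof (rule closed_subspace_UNIV[where K = K and S = D])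
    show "subspace {x. A (B x) = B (A x)}" using lin[OF A] lin[OF B]
      by (auto simp: subspace_def linear_add linear_scale linear_0)
    show "closed {x. A (B x) = B (A x)}"
      by (intro closed_Collect_eq bounded_linear.continuous_on[OF S(1)[OF A]]
          bounded_linear.continuous_on[OF S(1)[OF B]] continuous_intros)
    show "c *\<^sub>C K z \<in> {x. A (B x) = B (A x)}" if "z \<in> D" for c z
      using ABK[OF that] by (simp add: S(2) A B)
  next
    show "v = 0" if "\<And>z. z \<in> D \<Longrightarrow> cinner v (K z) = 0" for v by (rule totalK, rule that)
  qed
  then show ?thesis by (simp add: fun_eq_iff set_eq_iff)
qed

section \<open>Polarization\<close>

text \<open>Cauchy's estimate on the disc of radius \<open>\<rho>/2\<close> about \<open>z\<close>,
  which stays inside the given ball.\<close>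

lemma deriv_bound:
  assumes f: "f holomorphic_on ball 0 \<rho>" and M: "\<And>w. w \<in> ball 0 \<rho> \<Longrightarrow> cmod (f w) \<le> M"
    and z: "cmod z < \<rho> / 2"
  shows "cmod (deriv f z) \<le> 2 * M / \<rho>"
proof -
  have sub: "cball z (\<rho>/2) \<subseteq> ball 0 \<rho>"
    using z by (intro subsetI) (smt (verit) dist_norm field_sum_of_halves mem_ball_0 mem_cball norm_minus_commute norm_triangle_sub)
  have \<rho>: "\<rho> > 0" using z by (smt (verit) field_sum_of_halves norm_ge_zero)
  \<comment> \<open>The estimate is formulated for values in an open ball, so it is applied with
    every radius \<open>M'\<close> above \<open>M\<close>, and then \<open>M'\<close> tends to
    \<open>M\<close>.\<close>
  have "cmod ((deriv ^^ 1) f z) \<le> fact 1 * M' / (\<rho>/2)^1" if M': "M' > M" for M'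
  proof (rule Cauchy_higher_deriv_bound[where y = 0])
    show "f holomorphic_on ball z (\<rho>/2)"
      using f sub ball_subset_cball holomorphic_on_subset by blast
    show "continuous_on (cball z (\<rho>/2)) f"
      using f sub holomorphic_on_imp_continuous_on continuous_on_subset by blast
    show "f w \<in> ball 0 M'" if "w \<in> ball z (\<rho>/2)" for w
      using M[of w] sub that M' ball_subset_cball[of z "\<rho>/2"] by (fastforce simp: subset_iff)
  qed (use \<rho> in auto)
  then have "cmod (deriv f z) * (\<rho>/2) \<le> M'" if "M' > M" for M'
    using that \<rho> by (simp add: field_simps)
  then have "cmod (deriv f z) * (\<rho>/2) \<le> M" by (rule dense_ge)
  then show ?thesis using \<rho> by (simp add: field_simps)
qed

lemma holomorphic_lipschitz:
  assumes f: "f holomorphic_on ball 0 \<rho>" and M: "\<And>w. w \<in> ball 0 \<rho> \<Longrightarrow> cmod (f w) \<le> M"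
    and z: "cmod z < \<rho> / 2" and w: "cmod w < \<rho> / 2"
  shows "cmod (f z - f w) \<le> 2 * M / \<rho> * cmod (z - w)"
proof (rule field_differentiable_bound[where S = "ball 0 (\<rho>/2)" and f' = "deriv f"])
  fix x assume x: "x \<in> ball (0::complex) (\<rho>/2)"
  then have "x \<in> ball 0 \<rho>" using norm_ge_zero[of x] by (auto simp del: norm_ge_zero)
  then show "(f has_field_derivative deriv f x) (at x within ball 0 (\<rho>/2))"
    using f holomorphic_derivI by blast
  show "cmod (deriv f x) \<le> 2 * M / \<rho>" using x by (intro deriv_bound f M) auto
qed (use z w in auto)

text \<open>Osgood's lemma for bounded functions: Cauchy estimates make the partial derivatives Lipschitz.\<close>

lemma has_derivative_separately_holomorphic:
  fixes h :: "complex \<Rightarrow> complex \<Rightarrow> complex"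
  assumes h1: "\<And>b. b \<in> ball 0 \<rho> \<Longrightarrow> (\<lambda>a. h a b) holomorphic_on ball 0 \<rho>"
    and h2: "\<And>a. a \<in> ball 0 \<rho> \<Longrightarrow> h a holomorphic_on ball 0 \<rho>"
    and M: "\<And>a b. a \<in> ball 0 \<rho> \<Longrightarrow> b \<in> ball 0 \<rho> \<Longrightarrow> cmod (h a b) \<le> M"
    and a: "a \<in> ball 0 (\<rho>/4)" and b: "b \<in> ball 0 (\<rho>/4)"
  shows "((\<lambda>(a, b). h a b) has_derivative
     (\<lambda>(s, t). deriv (\<lambda>a. h a b) a * s + deriv (h a) b * t)) (at (a, b))"
proof -
  let ?S = "ball 0 (\<rho>/4) :: complex set"
  have \<rho>: "\<rho> > 0" using a by (smt (verit) divide_nonpos_pos mem_ball_0 norm_ge_zero)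
  have sub: "x \<in> ball 0 \<rho>" "cmod x < \<rho>/2" "cmod x < \<rho>/2/2" if "x \<in> ?S" for x
    using that \<rho> by auto
  \<comment> \<open>The first summand bounds the derivative of \<open>h x - h a\<close> by means of
    the Lipschitz estimate in the first variable; the second is the Lipschitz constant of
    \<open>deriv (h a)\<close> on the ball of radius \<open>\<rho>/2\<close>. Cauchy's estimate is
    used twice in a row and halves the radius each time, whence \<open>\<rho>/4\<close>.\<close>
  define C where "C = 2 * (2 * M / \<rho>) / \<rho> + 2 * (2 * M / \<rho>) / (\<rho>/2)"
  have lip: "cmod (deriv (h x) y - deriv (h a) b) \<le> C * (cmod (x - a) + cmod (y - b))"
    if x: "x \<in> ?S" and y: "y \<in> ?S" for x y
  proof -
    have M0: "M \<ge> 0" using M[of a b] a b \<rho> by (smt (verit) norm_ge_zero sub(1))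
    have 1: "cmod (deriv (h x) y - deriv (h a) y) \<le> 2 * (2 * M / \<rho> * cmod (x - a)) / \<rho>"
    proof -
      have hx: "h x holomorphic_on ball 0 \<rho>" "h a holomorphic_on ball 0 \<rho>"
        using h2 sub(1) x a by blast+
      have "deriv (\<lambda>w. h x w - h a w) y = deriv (h x) y - deriv (h a) y"
        using hx sub(1)[OF y] by (intro deriv_diff holomorphic_on_imp_differentiable_at) auto
      moreover have "cmod (deriv (\<lambda>w. h x w - h a w) y) \<le> 2 * (2 * M / \<rho> * cmod (x - a)) / \<rho>"
      proof (rule deriv_bound)
        show "(\<lambda>w. h x w - h a w) holomorphic_on ball 0 \<rho>" using hx by (intro holomorphic_intros)
        fix w assume w: "w \<in> ball (0::complex) \<rho>"
        show "cmod (h x w - h a w) \<le> 2 * M / \<rho> * cmod (x - a)"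
          by (rule holomorphic_lipschitz[OF h1[OF w]]) (use M w sub(2) x a in auto)
      qed (use sub(2) y in auto)
      ultimately show ?thesis by simp
    qed
    have "cmod (deriv (h a) y - deriv (h a) b) \<le> 2 * (2 * M / \<rho>) / (\<rho>/2) * cmod (y - b)"
    proof (rule holomorphic_lipschitz)
      have "h a holomorphic_on ball 0 \<rho>" using h2 sub(1) a by blast
      then show "deriv (h a) holomorphic_on ball 0 (\<rho>/2)"
        using holomorphic_deriv holomorphic_on_subset[of _ "ball 0 \<rho>" "ball 0 (\<rho>/2)"] \<rho>
        by (simp add: subset_ball)
      show "cmod (deriv (h a) w) \<le> 2 * M / \<rho>" if "w \<in> ball 0 (\<rho>/2)" for w
        using that h2 M sub(1) a by (intro deriv_bound) auto
    qed (use sub(3) y b in auto)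
    then have "cmod (deriv (h x) y - deriv (h a) b)
        \<le> 2 * (2 * M / \<rho> * cmod (x - a)) / \<rho> + 2 * (2 * M / \<rho>) / (\<rho>/2) * cmod (y - b)"
      using 1 norm_triangle_ineq[of "deriv (h x) y - deriv (h a) y" "deriv (h a) y - deriv (h a) b"]
      by simp
    also have "\<dots> \<le> C * (cmod (x - a) + cmod (y - b))"
      using \<rho> M0 unfolding C_def distrib_left distrib_right
      by (simp add: field_simps)
    finally show ?thesis .
  qed
  \<comment> \<open>Joint differentiability follows if both partial derivatives exist and one of
    them is continuous, here the one in the second variable. It is taken as a bounded linear map so
    that continuity refers to the operator norm.\<close>
  let ?fy = "\<lambda>x y. blinfun_mult_right (deriv (h x) y)"
  have nrm: "norm (blinfun_mult_right (p::complex) - blinfun_mult_right q) \<le> norm (p - q)" for p q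
    by (rule norm_blinfun_bound) (auto simp: blinfun.diff_left norm_mult simp flip: left_diff_distrib)
  have "((\<lambda>(a, b). h a b) has_derivative
     (\<lambda>(s, t). deriv (\<lambda>a. h a b) a * s + ?fy a b t)) (at (a, b) within ?S \<times> ?S)"
  proof (rule has_derivative_partialsI)
    have "(\<lambda>a. h a b) holomorphic_on ball 0 \<rho>" using h1 sub(1) b by blast
    then show "((\<lambda>a. h a b) has_derivative (*) (deriv (\<lambda>a. h a b) a)) (at a within ?S)"
      using holomorphic_derivI[of "\<lambda>a. h a b" "ball 0 \<rho>" a] sub(1)[OF a]
      by (auto simp: has_field_derivative_def intro: has_derivative_at_withinI)
    fix x y assume xy: "x \<in> ?S" "y \<in> ?S"
    then have "h x holomorphic_on ball 0 \<rho>" using h2 sub(1) by blast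
    then show "(h x has_derivative blinfun_apply (?fy x y)) (at y within ?S)"
      using holomorphic_derivI[of "h x" "ball 0 \<rho>" y] sub(1)[OF xy(2)]
      by (auto simp: has_field_derivative_def intro: has_derivative_at_withinI)
  next
    have "((\<lambda>p. ?fy (fst p) (snd p)) \<longlongrightarrow> ?fy a b) (at (a, b) within ?S \<times> ?S)"
    proof (rule Lim_transform_bound[THEN iffD2[OF Lim_null]])
      show "\<forall>\<^sub>F p in at (a, b) within ?S \<times> ?S. norm (?fy (fst p) (snd p) - ?fy a b)
          \<le> norm (C * (cmod (fst p - a) + cmod (snd p - b)))"
        unfolding eventually_at_topological
        by (rule exI[of _ UNIV]) (auto intro!: order_trans[OF nrm] order_trans[OF lip] abs_ge_self)
      show "((\<lambda>p. C * (cmod (fst p - a) + cmod (snd p - b))) \<longlongrightarrow> 0) (at (a, b) within ?S \<times> ?S)"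
        by (auto intro!: tendsto_eq_intros)
    qed
    then show "continuous (at (a, b) within ?S \<times> ?S) (\<lambda>(x, y). ?fy x y)"
      by (simp add: continuous_within split_def)
  qed (use a b in auto)
  moreover have "at (a, b) within ?S \<times> ?S = at (a, b)"
    using a b by (intro at_within_open open_Times) auto
  ultimately show ?thesis by (simp add: split_def)
qed

text \<open>In the coordinates \<open>a = x + \<i> y\<close>, \<open>b = x - \<i> y\<close> the antidiagonal is the set of real points.\<close>

lemma zero_if_zero_on_antidiagonal:
  fixes h :: "complex \<Rightarrow> complex \<Rightarrow> complex"
  assumes h1: "\<And>b. b \<in> ball 0 \<rho> \<Longrightarrow> (\<lambda>a. h a b) holomorphic_on ball 0 \<rho>"
    and h2: "\<And>a. a \<in> ball 0 \<rho> \<Longrightarrow> h a holomorphic_on ball 0 \<rho>"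
    and M: "\<And>a b. a \<in> ball 0 \<rho> \<Longrightarrow> b \<in> ball 0 \<rho> \<Longrightarrow> cmod (h a b) \<le> M"
    and diag: "\<And>a. a \<in> ball 0 \<rho> \<Longrightarrow> h a (cnj a) = 0"
    and a: "a \<in> ball 0 (\<rho>/8)" and b: "b \<in> ball 0 (\<rho>/8)"
  shows "h a b = 0"
proof -
  let ?S = "ball 0 (\<rho>/8) :: complex set"
  have \<rho>: "\<rho> > 0" using a by (smt (verit) divide_nonpos_pos mem_ball_0 norm_ge_zero)
  have lim: "(0::complex) islimpt (of_real ` {0<..<\<rho>/8})"
    unfolding islimpt_approachable
  proof (intro allI impI)
    fix e :: real assume "e > 0"
    define t where "t = min e (\<rho>/8) / 2"
    have "0 < t" "t < \<rho>/8" "t < e" using \<open>e > 0\<close> \<rho> by (auto simp: t_def)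
    then show "\<exists>x'\<in>complex_of_real ` {0<..<\<rho>/8}. x' \<noteq> 0 \<and> dist x' 0 < e"
      by (intro bexI[of _ "complex_of_real t"]) auto
  qed
  have sub: "of_real ` {0<..<\<rho>/8} \<subseteq> ?S" by auto
  \<comment> \<open>The radius \<open>\<rho>/8\<close> keeps both arguments of \<open>h\<close> in
    the ball of radius \<open>\<rho>/4\<close> where \<open>h\<close> is jointly differentiable.
    Both move when one of \<open>x\<close>, \<open>y\<close> does, so holomorphy of \<open>H\<close>
    in each variable rests on the joint derivative and the chain rule.\<close>
  define H where "H x y = h (x + \<i> * y) (x - \<i> * y)" for x y
  have in4: "x + \<i> * y \<in> ball 0 (\<rho>/4)" "x - \<i> * y \<in> ball 0 (\<rho>/4)" if "x \<in> ?S" "y \<in> ?S" for x y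
    using that norm_triangle_ineq[of x "\<i> * y"] norm_triangle_ineq4[of x "\<i> * y"]
    by (auto simp: norm_mult)
  have Hd: "((\<lambda>(x, y). H x y) has_derivative (\<lambda>(s, t). deriv (\<lambda>a. h a (x - \<i> * y)) (x + \<i> * y) * (s + \<i> * t)
      + deriv (h (x + \<i> * y)) (x - \<i> * y) * (s - \<i> * t))) (at (x, y))" if "x \<in> ?S" "y \<in> ?S" for x y
  proof -
    have "((\<lambda>p. (fst p + \<i> * snd p, fst p - \<i> * snd p)) has_derivative
        (\<lambda>p. (fst p + \<i> * snd p, fst p - \<i> * snd p))) (at (x, y))"
      by (auto intro!: derivative_eq_intros)
    from has_derivative_compose[OF this, of "\<lambda>p. h (fst p) (snd p)"
        "\<lambda>p. deriv (\<lambda>a. h a (x - \<i> * y)) (x + \<i> * y) * fst p + deriv (h (x + \<i> * y)) (x - \<i> * y) * snd p"]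
      has_derivative_separately_holomorphic[of \<rho> h M, OF h1 h2 M in4[OF that]]
    show ?thesis by (simp add: H_def split_def)
  qed
  have H1: "(\<lambda>x. H x y) holomorphic_on ?S" if y: "y \<in> ?S" for y
    unfolding holomorphic_on_open[OF open_ball]
  proof
    fix x assume x: "x \<in> ?S"
    have "((\<lambda>x. (x, y)) has_derivative (\<lambda>x. (x, 0))) (at x)"
      by (auto intro!: derivative_eq_intros)
    from has_derivative_compose[OF this Hd[OF x y]]
    have "((\<lambda>x. H x y) has_derivative (*) (deriv (\<lambda>a. h a (x - \<i> * y)) (x + \<i> * y) + deriv (h (x + \<i> * y)) (x - \<i> * y))) (at x)"
      by (auto simp: algebra_simps elim!: has_derivative_eq_rhs)
    then show "\<exists>f'. ((\<lambda>x. H x y) has_field_derivative f') (at x)"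
      by (auto simp: has_field_derivative_def)
  qed
  have H2: "H x holomorphic_on ?S" if x: "x \<in> ?S" for x
    unfolding holomorphic_on_open[OF open_ball]
  proof
    fix y assume y: "y \<in> ?S"
    have "((\<lambda>y. (x, y)) has_derivative (\<lambda>y. (0, y))) (at y)"
      by (auto intro!: derivative_eq_intros)
    from has_derivative_compose[OF this Hd[OF x y]]
    have "(H x has_derivative (*) (\<i> * deriv (\<lambda>a. h a (x - \<i> * y)) (x + \<i> * y) - \<i> * deriv (h (x + \<i> * y)) (x - \<i> * y))) (at y)"
      by (auto simp: algebra_simps elim!: has_derivative_eq_rhs)
    then show "\<exists>f'. (H x has_field_derivative f') (at y)"
      by (auto simp: has_field_derivative_def)
  qed
  have S_real: "complex_of_real x \<in> ?S" if "x \<in> {0<..<\<rho>/8}" for x using that by auto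
  have S0: "0 \<in> ?S" using \<rho> by simp
  \<comment> \<open>For real \<open>x\<close> and \<open>y\<close> the two arguments of
    \<open>h\<close> are conjugate to each other. The identity theorem then frees first
    \<open>x\<close> and afterwards \<open>y\<close> from being real.\<close>
  have real: "H (of_real x) (of_real y) = 0" if "x \<in> {0<..<\<rho>/8}" "y \<in> {0<..<\<rho>/8}" for x y
  proof -
    have "of_real x + \<i> * of_real y \<in> ball 0 (\<rho>/4)" using that by (intro in4 S_real)
    then have "of_real x + \<i> * of_real y \<in> ball 0 \<rho>" using \<rho> by simp
    from diag[OF this] show ?thesis by (simp add: H_def)
  qed
  have 1: "H x (of_real y) = 0" if x: "x \<in> ?S" and y: "y \<in> {0<..<\<rho>/8}" for x y
  proof (rule analytic_continuation[OF H1[OF S_real[OF y]] open_ball connected_ball sub S0 lim _ x])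
    show "H z (of_real y) = 0" if "z \<in> of_real ` {0<..<\<rho>/8}" for z
      using that real[OF _ y] by (elim imageE) simp
  qed
  have 2: "H x y = 0" if x: "x \<in> ?S" and y: "y \<in> ?S" for x y
  proof (rule analytic_continuation[OF H2[OF x] open_ball connected_ball sub S0 lim _ y])
    show "H x z = 0" if "z \<in> of_real ` {0<..<\<rho>/8}" for z
      using that 1[OF x] by (elim imageE) simp
  qed
  have "cmod (a + b) < \<rho>/4" "cmod (a - b) < \<rho>/4"
    using a b norm_triangle_ineq[of a b] norm_triangle_ineq4[of a b] by simp_all
  \<comment> \<open>The solution of \<open>a = x + \<i> * y\<close>,
    \<open>b = x - \<i> * y\<close>.\<close>
  then have "H ((a + b) / 2) (- \<i> * (a - b) / 2) = 0"
    by (intro 2) (simp_all add: norm_mult norm_divide)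
  moreover have "(a + b) / 2 + \<i> * (- \<i> * (a - b) / 2) = a"
    "(a + b) / 2 - \<i> * (- \<i> * (a - b) / 2) = b"
    by (simp_all add: field_simps)
  ultimately show ?thesis by (simp only: H_def)
qed

text \<open>Conjugating the second variable turns the diagonal into the antidiagonal, so
  \<open>g\<close> vanishes near \<open>(a, a)\<close>; connectedness then spreads the zeros in one
  variable at a time. The bound on compact sets feeds Osgood's lemma.\<close>

lemma polarization:
  fixes g :: "complex \<Rightarrow> complex \<Rightarrow> complex"
  assumes S: "open S" "connected S"
    and g1: "\<And>b. b \<in> S \<Longrightarrow> (\<lambda>a. g a b) holomorphic_on S"
    and g2: "\<And>a. a \<in> S \<Longrightarrow> (\<lambda>b. cnj (g a b)) holomorphic_on S"
    and bdd: "\<And>C. compact C \<Longrightarrow> C \<subseteq> S \<Longrightarrow> \<exists>M. \<forall>a\<in>C. \<forall>b\<in>C. cmod (g a b) \<le> M"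
    and diag: "\<And>a. a \<in> S \<Longrightarrow> g a a = 0"
    and a: "a \<in> S" and b: "b \<in> S"
  shows "g a b = 0"
proof -
  obtain \<rho> where \<rho>: "\<rho> > 0" "cball a \<rho> \<subseteq> S" using S(1) a open_contains_cball by blast
  obtain M where M: "\<And>x y. x \<in> cball a \<rho> \<Longrightarrow> y \<in> cball a \<rho> \<Longrightarrow> cmod (g x y) \<le> M"
    using bdd[OF compact_cball \<rho>(2)] by blast
  have mem: "a + x \<in> cball a \<rho>" "a + cnj x \<in> cball a \<rho>" "a + x \<in> S" "a + cnj x \<in> S"
    if "x \<in> ball 0 \<rho>" for x
    using that \<rho>(2) by (auto simp: dist_norm subset_iff)
  define h where "h x y = g (a + x) (a + cnj y)" for x y
  have shift: "(\<lambda>x. a + x) holomorphic_on ball 0 \<rho>" by (intro holomorphic_intros)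
  have shift_image: "(\<lambda>x. a + x) ` ball 0 \<rho> \<subseteq> S" using mem(3) by (rule image_subsetI)
  have h0: "h x y = 0" if "x \<in> ball 0 (\<rho>/8)" "y \<in> ball 0 (\<rho>/8)" for x y
  proof (rule zero_if_zero_on_antidiagonal[of \<rho> h M])
    show "(\<lambda>x. h x y) holomorphic_on ball 0 \<rho>" if "y \<in> ball 0 \<rho>" for y
      using holomorphic_on_compose_gen[OF shift g1[OF mem(4)[OF that]] shift_image]
      by (simp add: o_def h_def)
    show "h x holomorphic_on ball 0 \<rho>" if "x \<in> ball 0 \<rho>" for x
    proof -
      have "(\<lambda>y. cnj (g (a + x) (a + y))) holomorphic_on ball 0 \<rho>"
        using holomorphic_on_compose_gen[OF shift g2[OF mem(3)[OF that]] shift_image]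
        by (simp add: o_def)
      moreover have "cnj ` ball 0 \<rho> = ball 0 \<rho>"
        by (auto simp: image_cnj_conv_vimage_cnj)
      ultimately have "cnj \<circ> (\<lambda>y. cnj (g (a + x) (a + y))) \<circ> cnj holomorphic_on ball 0 \<rho>"
        by (intro holomorphic_on_compose_cnj_cnj) auto
      then show ?thesis by (simp add: h_def[abs_def] o_def)
    qed
    show "cmod (h x y) \<le> M" if "x \<in> ball 0 \<rho>" "y \<in> ball 0 \<rho>" for x y
      unfolding h_def using that by (intro M mem)
    show "h x (cnj x) = 0" if "x \<in> ball 0 \<rho>" for x
      using diag[OF mem(3)[OF that]] by (simp add: h_def)
  qed (fact that)+
  have near: "g x y = 0" if "x \<in> ball a (\<rho>/8)" "y \<in> ball a (\<rho>/8)" for x y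
    using h0[of "x - a" "cnj (y - a)"] that
    by (simp add: h_def dist_norm norm_minus_commute flip: complex_cnj_diff)
  have sub: "ball a (\<rho>/8) \<subseteq> S" and ne: "ball a (\<rho>/8) \<noteq> {}" using \<rho> by (auto simp: subset_iff)
  have 1: "g x y = 0" if "x \<in> S" "y \<in> ball a (\<rho>/8)" for x y
    using that(2) sub near
    by (intro analytic_continuation_open[OF open_ball S(1) ne S(2) sub g1 holomorphic_on_const _ that(1)]) blast+
  have "cnj (g a b) = 0"
    using 1[OF a]
    by (intro analytic_continuation_open[OF open_ball S(1) ne S(2) sub g2[OF a] holomorphic_on_const _ b]) simp
  then show ?thesis by simp
qed

section \<open>Manifolds and line bundles\<close>

lemma holo_on_subset: "holo_on S f \<Longrightarrow> R \<subseteq> S \<Longrightarrow> holo_on R f"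
  by (auto simp: holo_on_def)

lemma holo_on_imp_continuous_on: "holo_on S f \<Longrightarrow> continuous_on S f"
  unfolding holo_on_def
  by (blast intro: continuous_at_imp_continuous_on has_derivative_continuous)

lemma antiholo_on_imp_continuous_on: "antiholo_on S f \<Longrightarrow> continuous_on S f"
  unfolding antiholo_on_def
  by (blast intro: continuous_at_imp_continuous_on has_derivative_continuous)

lemma holo_on_cong:
  assumes "open S" "\<And>x. x \<in> S \<Longrightarrow> f x = g x" "holo_on S f"
  shows "holo_on S g"
  using assms unfolding holo_on_def by (metis has_derivative_transform_within_open)

lemma holo_on_snd: "holo_on S f \<Longrightarrow> holo_on S (\<lambda>z. snd (f z))"
  unfolding holo_on_def by (fastforce intro: has_derivative_snd simp: scaleC_prod_def)

lemma holo_on_mult: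
  fixes f g :: "'a::complex_normed_vector \<Rightarrow> complex"
  assumes "holo_on S f" "holo_on S g"
  shows "holo_on S (\<lambda>z. f z * g z)"
  unfolding holo_on_def
proof
  fix x assume "x \<in> S"
  then obtain f' g' where "(f has_derivative f') (at x)" "\<forall>c v. f' (c *\<^sub>C v) = c *\<^sub>C f' v"
    "(g has_derivative g') (at x)" "\<forall>c v. g' (c *\<^sub>C v) = c *\<^sub>C g' v"
    using assms unfolding holo_on_def by metis
  then show "\<exists>d. ((\<lambda>z. f z * g z) has_derivative d) (at x) \<and> (\<forall>c v. d (c *\<^sub>C v) = c *\<^sub>C d v)"
    by (intro exI[of _ "\<lambda>h. f x * g' h + f' h * g x"])
      (auto intro!: has_derivative_mult simp: scaleC_complex_def algebra_simps)
qed

lemma holo_on_compose_field_differentiable: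
  fixes f :: "'a::complex_normed_vector \<Rightarrow> complex"
  assumes "holo_on S f" "\<And>z. z \<in> S \<Longrightarrow> g field_differentiable (at (f z))"
  shows "holo_on S (\<lambda>z. g (f z))"
  unfolding holo_on_def
proof
  fix x assume x: "x \<in> S"
  then obtain f' where f': "(f has_derivative f') (at x)" "\<forall>c v. f' (c *\<^sub>C v) = c *\<^sub>C f' v"
    using assms(1) unfolding holo_on_def by metis
  obtain d where "(g has_derivative (*) d) (at (f x))"
    using assms(2)[OF x] by (auto simp: field_differentiable_def has_field_derivative_def)
  from has_derivative_compose[OF f'(1) this] f'(2)
  show "\<exists>d. ((\<lambda>z. g (f z)) has_derivative d) (at x) \<and> (\<forall>c v. d (c *\<^sub>C v) = c *\<^sub>C d v)"
    by (auto simp: scaleC_complex_def)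
qed

text \<open>Two conjugations cancel. This makes data over \<sigma> x (values of sections, the factor
  of \<Psi>) holomorphic in the coordinate of x after conjugation.\<close>

lemma holo_on_cnj_antiholo:
  fixes f :: "'b::complex_normed_vector \<Rightarrow> complex"
  assumes g: "antiholo_on S g" and f: "holo_on R f" and sub: "g ` S \<subseteq> R"
  shows "holo_on S (\<lambda>z. cnj (f (g z)))"
  unfolding holo_on_def
proof
  fix x assume x: "x \<in> S"
  obtain g' where g': "(g has_derivative g') (at x)" "\<forall>c v. g' (c *\<^sub>C v) = cnj c *\<^sub>C g' v"
    using g x unfolding antiholo_on_def by metis
  obtain f' where f': "(f has_derivative f') (at (g x))" "\<forall>c v. f' (c *\<^sub>C v) = c *\<^sub>C f' v"
    using f x sub unfolding holo_on_def by (metis image_subset_iff)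
  from bounded_linear.has_derivative[OF bounded_linear_cnj has_derivative_compose[OF g'(1) f'(1)]]
  show "\<exists>d. ((\<lambda>z. cnj (f (g z))) has_derivative d) (at x) \<and> (\<forall>c v. d (c *\<^sub>C v) = c *\<^sub>C d v)"
    using g'(2) f'(2) by (auto simp: scaleC_complex_def)
qed

section \<open>Reduction to one complex variable along affine lines\<close>

lemma continuous_on_complex_line: "continuous_on S (\<lambda>\<xi>. a + \<xi> *\<^sub>C (d::'e::complex_normed_vector))"
  by (intro continuous_intros linear_continuous_on bounded_linear_scaleC_left)

lemma holomorphic_on_complex_line:
  fixes f :: "'e::complex_normed_vector \<Rightarrow> complex"
  assumes "holo_on S f"
  shows "(\<lambda>\<xi>. f (a + \<xi> *\<^sub>C d)) holomorphic_on {\<xi>. a + \<xi> *\<^sub>C d \<in> S}"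
  unfolding holomorphic_on_def
proof
  fix \<xi> assume "\<xi> \<in> {\<xi>. a + \<xi> *\<^sub>C d \<in> S}"
  then obtain f' where f': "(f has_derivative f') (at (a + \<xi> *\<^sub>C d))" "\<forall>c v. f' (c *\<^sub>C v) = c *\<^sub>C f' v"
    using assms unfolding holo_on_def by blast
  have "((\<lambda>\<xi>. a + \<xi> *\<^sub>C d) has_derivative (\<lambda>h. 0 + h *\<^sub>C d)) (at \<xi>)"
    by (intro has_derivative_add has_derivative_const bounded_linear_imp_has_derivative
        bounded_linear_scaleC_left)
  from has_derivative_compose[OF this f'(1)]
  have "((\<lambda>\<xi>. f (a + \<xi> *\<^sub>C d)) has_derivative (*) (f' d)) (at \<xi>)"
    using f'(2) by (simp add: scaleC_complex_def mult_commute_abs)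
  then show "(\<lambda>\<xi>. f (a + \<xi> *\<^sub>C d)) field_differentiable at \<xi> within {\<xi>. a + \<xi> *\<^sub>C d \<in> S}"
    by (metis field_differentiable_at_within field_differentiable_def has_field_derivative_def)
qed

lemma open_complex_line: "open S \<Longrightarrow> open {\<xi>. a + \<xi> *\<^sub>C (d::'e::complex_normed_vector) \<in> S}"
  using open_vimage[OF _ continuous_on_complex_line, of S a d] by (simp add: vimage_def)

lemma convex_complex_line:
  assumes "convex S"
  shows "convex {\<xi>. a + \<xi> *\<^sub>C (d::'e::complex_normed_vector) \<in> S}"
proof (rule convexI, clarsimp)
  fix x y u v assume *: "a + x *\<^sub>C d \<in> S" "a + y *\<^sub>C d \<in> S" "0 \<le> u" "0 \<le> v" "u + v = (1::real)"
  have "(r *\<^sub>R \<xi>) *\<^sub>C d = r *\<^sub>R \<xi> *\<^sub>C d" for r \<xi>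
    by (simp add: scaleR_conv_of_real flip: scaleC_of_real scaleC_scaleC)
  then have "u *\<^sub>R (a + x *\<^sub>C d) + v *\<^sub>R (a + y *\<^sub>C d)
      = (u + v) *\<^sub>R a + (u *\<^sub>R x + v *\<^sub>R y) *\<^sub>C d"
    by (simp add: algebra_simps scaleC_add_left)
  then show "a + (u *\<^sub>R x + v *\<^sub>R y) *\<^sub>C d \<in> S"
    using convexD[OF assms *(1,2,3,4,5)] *(5) by simp
qed

text \<open>The one-variable identity theorem on the line from \<open>a\<close> (parameter 0) to
  \<open>z\<close> (parameter 1); convexity of \<open>S\<close> makes its slice connected.\<close>

lemma holo_on_zero_if_locally_zero:
  fixes f :: "'e::complex_normed_vector \<Rightarrow> complex"
  assumes f: "holo_on S f" and S: "open S" "convex S"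
    and N: "open N" "a \<in> N" "a \<in> S" "\<And>x. x \<in> N \<inter> S \<Longrightarrow> f x = 0" and z: "z \<in> S"
  shows "f z = 0"
proof -
  let ?V = "\<lambda>S. {\<xi>. a + \<xi> *\<^sub>C (z - a) \<in> S}"
  have "f (a + 1 *\<^sub>C (z - a)) = 0"
  proof (rule analytic_continuation_open[where s = "?V (N \<inter> S)" and s' = "?V S"
        and g = "\<lambda>_. 0" and f = "\<lambda>\<xi>. f (a + \<xi> *\<^sub>C (z - a))"])
    have "0 \<in> ?V (N \<inter> S)" using N scaleC_of_real[of 0 "z - a"] by simp
    then show "?V (N \<inter> S) \<noteq> {}" by blast
    show "open (?V (N \<inter> S))" "open (?V S)" using N S by (simp_all only: open_complex_line open_Int)
    show "connected (?V S)" using S by (intro convex_connected convex_complex_line)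
    show "(\<lambda>\<xi>. f (a + \<xi> *\<^sub>C (z - a))) holomorphic_on ?V S"
      using f by (rule holomorphic_on_complex_line)
    show "f (a + \<xi> *\<^sub>C (z - a)) = 0" if "\<xi> \<in> ?V (N \<inter> S)" for \<xi>
      using that N(4) by blast
  qed (use z in auto)
  then show ?thesis by simp
qed

section \<open>Charts and continuity of manifold maps\<close>

lemma manifold_atlasD:
  assumes "manifold_atlas C A" "(U, \<phi>) \<in> A"
  shows "open U" "open (\<phi> ` U)" "homeomorphism U (\<phi> ` U) \<phi> (inv_into U \<phi>)"
  using assms unfolding manifold_atlas_def by fast+

lemma manifold_atlas_chart:
  assumes "manifold_atlas C A"
  obtains U \<phi> where "(U, \<phi>) \<in> A" "x \<in> U"
proof -
  have "x \<in> \<Union>(fst ` A)" using assms by (simp add: manifold_atlas_def)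
  then obtain p where "p \<in> A" "x \<in> fst p" by blast
  then show thesis using that[of "fst p" "snd p"] by simp
qed

lemma chart_inverse:
  assumes "manifold_atlas C A" "(U, \<phi>) \<in> A"
  shows "x \<in> U \<Longrightarrow> inv_into U \<phi> (\<phi> x) = x" "continuous_on U \<phi>"
    "continuous_on (\<phi> ` U) (inv_into U \<phi>)" "inj_on \<phi> U"
  using manifold_atlasD(3)[OF assms] by (auto simp: homeomorphism_def intro: inj_on_inverseI)

lemma chart_open_image:
  assumes A: "manifold_atlas C A" "(U, \<phi>) \<in> A" and N: "open N"
  shows "open (\<phi> ` (U \<inter> N))"
proof -
  have "openin (top_of_set U) (U \<inter> N)" using N by auto
  from homeomorphism_imp_open_map[OF manifold_atlasD(3)[OF A] this]
  show ?thesis using manifold_atlasD(2)[OF A] openin_open_trans by blast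
qed

lemma chart_inverse_open_image:
  assumes A: "manifold_atlas C A" "(U, \<phi>) \<in> A" and N: "open N" "N \<subseteq> \<phi> ` U"
  shows "open (inv_into U \<phi> ` N)"
proof -
  have "inv_into U \<phi> ` N = U \<inter> \<phi> -` N"
  proof (intro equalityI subsetI)
    fix x assume "x \<in> inv_into U \<phi> ` N"
    then obtain y where "y \<in> U" "\<phi> y \<in> N" "x = inv_into U \<phi> (\<phi> y)" using N(2) by blast
    then show "x \<in> U \<inter> \<phi> -` N" by (simp add: chart_inverse(1)[OF A])
  next
    fix x assume "x \<in> U \<inter> \<phi> -` N"
    then show "x \<in> inv_into U \<phi> ` N"
      by (intro image_eqI[of _ _ "\<phi> x"]) (simp_all add: chart_inverse(1)[OF A])
  qed
  then show ?thesis
    using continuous_open_preimage[OF chart_inverse(2)[OF A] manifold_atlasD(1)[OF A] N(1)] by simp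
qed

lemma manifold_map_continuous:
  assumes A: "manifold_atlas C1 A" and B: "manifold_atlas C2 B" and F: "manifold_map C A B F"
    and C: "\<And>S f. C S f \<Longrightarrow> continuous_on S f"
  shows "continuous_on UNIV F"
proof (intro continuous_at_imp_continuous_on ballI)
  fix x
  obtain U \<phi> where U: "(U, \<phi>) \<in> A" "x \<in> U" using manifold_atlas_chart[OF A] .
  obtain V \<psi> where V: "(V, \<psi>) \<in> B" "F x \<in> V" using manifold_atlas_chart[OF B] .
  let ?N = "U \<inter> F -` V"
  have "open (\<phi> ` ?N)" and cF: "continuous_on (\<phi> ` ?N) (\<psi> \<circ> F \<circ> inv_into U \<phi>)"
    using F U(1) V(1) C unfolding manifold_map_def by fast+
  then have "open (inv_into U \<phi> ` \<phi> ` ?N)"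
    by (intro chart_inverse_open_image[OF A U(1)]) auto
  moreover have "inv_into U \<phi> ` \<phi> ` ?N = ?N"
    by (force simp: chart_inverse(1)[OF A U(1)])
  ultimately have N: "open ?N" by simp
  have "continuous_on ?N (inv_into V \<psi> \<circ> ((\<psi> \<circ> F \<circ> inv_into U \<phi>) \<circ> \<phi>))"
    by (intro continuous_on_compose continuous_on_subset[OF chart_inverse(2)[OF A U(1)]] cF
        continuous_on_subset[OF chart_inverse(3)[OF B V(1)]])
      (auto simp: chart_inverse(1)[OF A U(1)])
  then have "continuous_on ?N F"
    by (rule continuous_on_eq) (simp add: chart_inverse(1)[OF A U(1)] chart_inverse(1)[OF B V(1)])
  then show "isCont F x" using N U(2) V(2) continuous_on_eq_continuous_at by blast
qed

section \<open>Fibre coordinates and local frames\<close>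

lemma trivD:
  assumes L: "holomorphic_line_bundle A L" and U: "(U, \<tau>) \<in> trivs L"
  shows triv_open: "open U"
    and triv_scale: "v \<in> total L \<Longrightarrow> proj L v \<in> U \<Longrightarrow> \<tau> (fscale L c v) = c * \<tau> v"
    and triv_add: "v \<in> total L \<Longrightarrow> w \<in> total L \<Longrightarrow> proj L v \<in> U \<Longrightarrow> proj L v = proj L w \<Longrightarrow>
      \<tau> (fadd L v w) = \<tau> v + \<tau> w"
    and triv_bij: "bij_betw (\<lambda>v. (proj L v, \<tau> v)) {v \<in> total L. proj L v \<in> U} (U \<times> UNIV)"
  using L U unfolding holomorphic_line_bundle_def by fast+

lemma triv_inj:
  assumes "holomorphic_line_bundle A L" "(U, \<tau>) \<in> trivs L" "v \<in> total L" "w \<in> total L"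
    "proj L v \<in> U" "proj L v = proj L w" "\<tau> v = \<tau> w"
  shows "v = w"
  by (rule inj_onD[OF bij_betw_imp_inj_on[OF triv_bij[OF assms(1,2)]]]) (use assms in auto)

lemma triv_surj:
  assumes "holomorphic_line_bundle A L" "(U, \<tau>) \<in> trivs L" "x \<in> U"
  obtains v where "v \<in> total L" "proj L v = x" "\<tau> v = a"
proof -
  have "(x, a) \<in> (\<lambda>v. (proj L v, \<tau> v)) ` {v \<in> total L. proj L v \<in> U}"
    using bij_betw_imp_surj_on[OF triv_bij[OF assms(1,2)]] assms(3) by simp
  then show thesis using that by auto
qed

lemma bundle_triv:
  assumes "holomorphic_line_bundle A L"
  obtains U \<tau> where "(U, \<tau>) \<in> trivs L" "x \<in> U"
proof -
  have "x \<in> \<Union>(fst ` trivs L)" using assms by (simp add: holomorphic_line_bundle_def)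
  then obtain p where "p \<in> trivs L" "x \<in> fst p" by blast
  then show thesis using that[of "fst p" "snd p"] by simp
qed

lemma fscale_closed:
  assumes "holomorphic_line_bundle A L" "v \<in> total L"
  shows "fscale L c v \<in> total L" "proj L (fscale L c v) = proj L v"
  using assms unfolding holomorphic_line_bundle_def by fast+

text \<open>Coordinates of the same vector differ by a factor, so vanishing of a section at a point
  can be tested in any one trivialization.\<close>

lemma triv_eq_0:
  assumes L: "holomorphic_line_bundle A L" and "(U, \<tau>) \<in> trivs L" "(V, \<rho>) \<in> trivs L"
    and "v \<in> total L" "proj L v \<in> U" "proj L v \<in> V" "\<tau> v = 0"
  shows "\<rho> v = 0"
proof -
  have "\<forall>(U, \<tau>)\<in>trivs L. \<forall>(V, \<rho>)\<in>trivs L. \<exists>g.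
      holomorphic_fun_on A (U \<inter> V) g \<and> (\<forall>x\<in>U \<inter> V. g x \<noteq> 0) \<and>
      (\<forall>v\<in>total L. proj L v \<in> U \<inter> V \<longrightarrow> \<rho> v = g (proj L v) * \<tau> v)"
    using L unfolding holomorphic_line_bundle_def by (elim conjE)
  from bspec[OF bspec[OF this assms(2), unfolded split_conv] assms(3), unfolded split_conv]
  obtain g where "\<forall>v\<in>total L. proj L v \<in> U \<inter> V \<longrightarrow> \<rho> v = g (proj L v) * \<tau> v"
    by (elim exE conjE)
  then show ?thesis using assms(4-) by simp
qed

text \<open>Reduces the study of a fibrewise linear map to its value on a vector \<open>e\<close> of
  coordinate 1.\<close>

lemma triv_fscale_decompose:
  assumes L: "holomorphic_line_bundle A L" and U: "(U, \<tau>) \<in> trivs L"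
    and "v \<in> total L" "e \<in> total L" "proj L v \<in> U" "proj L e = proj L v" "\<tau> e = 1"
  shows "v = fscale L (\<tau> v) e"
  by (rule triv_inj[OF L U]) (use assms fscale_closed[OF L] triv_scale[OF L U] in auto)

section \<open>Holomorphic sections and the identity theorem\<close>

lemma sectionD:
  assumes "s \<in> holomorphic_sections A L"
  shows "s x \<in> total L" "proj L (s x) = x" "holomorphic_map A (total_atlas A L) s"
  using assms by (auto simp: holomorphic_sections_def)

lemma manifold_mapD:
  assumes "manifold_map C A B F" "(U, \<phi>) \<in> A" "(V, \<psi>) \<in> B"
  shows "C (\<phi> ` (U \<inter> F -` V)) (\<psi> \<circ> F \<circ> inv_into U \<phi>)"
proof -
  have "\<forall>(U, \<phi>)\<in>A. \<forall>(V, \<psi>)\<in>B. open (\<phi> ` (U \<inter> F -` V)) \<and>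
      C (\<phi> ` (U \<inter> F -` V)) (\<psi> \<circ> F \<circ> inv_into U \<phi>)"
    using assms(1) unfolding manifold_map_def by (elim conjE)
  from bspec[OF bspec[OF this assms(2), unfolded split_conv] assms(3), unfolded split_conv]
  show ?thesis by (elim conjE)
qed

lemma holo_on_section_coordinate:
  assumes s: "s \<in> holomorphic_sections A L" and W: "(W, \<phi>) \<in> A" and U: "(U, \<tau>) \<in> trivs L"
  shows "holo_on (\<phi> ` (W \<inter> U)) (\<lambda>z. \<tau> (s (inv_into W \<phi> z)))"
proof -
  let ?X = "{v \<in> total L. proj L v \<in> W \<inter> U}"
  have "(?X, \<lambda>v. (\<phi> (proj L v), \<tau> v)) \<in> total_atlas A L"
    using W U unfolding total_atlas_def by blast
  from holo_on_snd[OF manifold_mapD[OF sectionD(3)[OF s] W this]]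
  have "holo_on (\<phi> ` (W \<inter> s -` ?X)) (\<lambda>z. \<tau> (s (inv_into W \<phi> z)))" by simp
  moreover have "W \<inter> s -` ?X = W \<inter> U" using sectionD[OF s] by auto
  ultimately show ?thesis by simp
qed

text \<open>The interior \<open>Z\<close> of the zero set is also closed: a coordinate ball about a
  point of its closure meets \<open>Z\<close>, so the section vanishes near some point of the ball
  and hence on all of it. Connectedness leaves only the whole manifold.\<close>

lemma section_identity_theorem:
  assumes A: "complex_manifold A" and conn: "connected (UNIV::'d::{t2_space,second_countable_topology} set)"
    and L: "holomorphic_line_bundle A (L::('l,'d) line_bundle)" and s: "s \<in> holomorphic_sections A L"
    and N: "open N" "N \<noteq> {}" "\<And>x U \<tau>. x \<in> N \<Longrightarrow> (U, \<tau>) \<in> trivs L \<Longrightarrow> x \<in> U \<Longrightarrow> \<tau> (s x) = 0"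
    and U: "(U, \<tau>) \<in> trivs L" "x \<in> U"
  shows "\<tau> (s x) = 0"
proof -
  note A' = A[unfolded complex_manifold_def]
  define Z where "Z = interior {x. \<forall>U \<tau>. (U, \<tau>) \<in> trivs L \<longrightarrow> x \<in> U \<longrightarrow> \<tau> (s x) = 0}"
  have "x \<in> Z" if x: "x \<in> closure Z" for x
  proof -
    obtain W \<phi> where W: "(W, \<phi>) \<in> A" "x \<in> W" using manifold_atlas_chart[OF A'] .
    obtain U \<tau> where U: "(U, \<tau>) \<in> trivs L" "x \<in> U" using bundle_triv[OF L] .
    note inv = chart_inverse(1)[OF A' W(1)]
    have "open (\<phi> ` (W \<inter> U))" using chart_open_image[OF A' W(1) triv_open[OF L U(1)]] .
    moreover have "\<phi> x \<in> \<phi> ` (W \<inter> U)" using W U by blast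
    ultimately obtain r where r: "r > 0" "ball (\<phi> x) r \<subseteq> \<phi> ` (W \<inter> U)"
      using open_contains_ball by metis
    \<comment> \<open>The preimage of a coordinate ball, because the identity theorem in coordinates
      is stated for convex sets.\<close>
    define B where "B = W \<inter> \<phi> -` ball (\<phi> x) r"
    have B: "open B" unfolding B_def
      by (rule continuous_open_preimage[OF chart_inverse(2)[OF A' W(1)] manifold_atlasD(1)[OF A' W(1)] open_ball])
    have xB: "x \<in> B" unfolding B_def using r W by simp
    have BU: "y \<in> U" if "y \<in> B" for y
    proof -
      have "\<phi> y \<in> \<phi> ` (W \<inter> U)" using that r(2) unfolding B_def by blast
      then show ?thesis using that inv unfolding B_def by (metis IntD1 IntD2 imageE)
    qed
    obtain y where y: "y \<in> B" "y \<in> Z" using x B xB closure_iff_nhds_not_empty[of x Z] by blast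
    have Zopen: "open Z" by (simp add: Z_def)
    have f0: "\<tau> (s (inv_into W \<phi> z)) = 0" if z: "z \<in> ball (\<phi> x) r" for z
    proof (rule holo_on_zero_if_locally_zero[OF holo_on_subset[OF holo_on_section_coordinate[OF s W(1) U(1)] r(2)]])
      show "open (\<phi> ` (W \<inter> Z))" using chart_open_image[OF A' W(1) Zopen] .
      show "\<phi> y \<in> \<phi> ` (W \<inter> Z)" "\<phi> y \<in> ball (\<phi> x) r" using y by (auto simp: B_def)
      fix z assume "z \<in> \<phi> ` (W \<inter> Z) \<inter> ball (\<phi> x) r"
      then obtain w where w: "w \<in> W" "w \<in> Z" "z = \<phi> w" "w \<in> B" by (auto simp: B_def)
      have "\<tau> (s w) = 0" using w(2) U(1) BU[OF w(4)] interior_subset unfolding Z_def by blast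
      then show "\<tau> (s (inv_into W \<phi> z)) = 0" by (simp add: w inv)
    qed (use z in auto)
    have "B \<subseteq> {x. \<forall>U \<tau>. (U, \<tau>) \<in> trivs L \<longrightarrow> x \<in> U \<longrightarrow> \<tau> (s x) = 0}"
    proof clarify
      fix w V \<rho> assume w: "w \<in> B" and V: "(V, \<rho>) \<in> trivs L" "w \<in> V"
      have "\<tau> (s w) = 0" using f0[of "\<phi> w"] w inv by (auto simp: B_def)
      then show "\<rho> (s w) = 0"
        using triv_eq_0[OF L U(1) V(1)] sectionD[OF s] BU[OF w] V(2) by metis
    qed
    then have "B \<subseteq> Z" unfolding Z_def using B by (rule interior_maximal)
    then show ?thesis using xB by blast
  qed
  then have "closed Z" using closure_subset_eq by blast
  moreover have "open Z" by (simp add: Z_def)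
  moreover have "N \<subseteq> Z" unfolding Z_def using N(1,3) by (intro interior_maximal) auto
  ultimately have "Z = UNIV" using conn N(2) connected_clopen[of "UNIV::'d set"] by auto
  then show ?thesis using U interior_subset unfolding Z_def by blast
qed

text \<open>A fibre coordinate of the conjugated pull-back is the conjugate of a coordinate of
  \<open>L\<close> over \<sigma> x. In it \<Psi> is complex linear on fibres, hence multiplication
  by a factor, and holomorphy of \<Psi> on the total space makes this factor holomorphic.\<close>

lemma conj_pullback_iso_coordinate:
  assumes L: "holomorphic_line_bundle A L" and A: "manifold_atlas C A"
    and \<Psi>: "line_bundle_iso A L (conj_bundle (pullback_bundle \<sigma> L)) \<Psi>"
    and W: "(W, \<phi>) \<in> A" and U: "(U, \<tau>) \<in> trivs L" and V: "(V, \<rho>) \<in> trivs L"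
  obtains P where "holo_on (\<phi> ` (W \<inter> U \<inter> \<sigma> -` V)) P"
    "\<And>v. v \<in> total L \<Longrightarrow> proj L v \<in> W \<inter> U \<inter> \<sigma> -` V \<Longrightarrow>
       cnj (\<rho> (snd (\<Psi> v))) = P (\<phi> (proj L v)) * \<tau> v"
proof -
  define M where "M = conj_bundle (pullback_bundle \<sigma> L)"
  note \<Psi> = \<Psi>[folded M_def]
  define Q where "Q = {v \<in> total L. proj L v \<in> W \<inter> U}"
  define \<kappa> where "\<kappa> = (\<lambda>v. (\<phi> (proj L v), \<tau> v))"
  define R where "R = {m \<in> total M. proj M m \<in> W \<inter> \<sigma> -` V}"
  define \<omega> where "\<omega> = (\<lambda>m. (\<phi> (proj M m), cnj ((\<lambda>(x, v). \<rho> v) m)))"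
  have Q: "(Q, \<kappa>) \<in> total_atlas A L" unfolding total_atlas_def Q_def \<kappa>_def
    by (rule CollectI, rule exI[of _ W], rule exI[of _ \<phi>], rule exI[of _ U], rule exI[of _ \<tau>])
      (simp add: W U)
  have MV: "(\<sigma> -` V, \<lambda>m. cnj ((\<lambda>(x, v). \<rho> v) m)) \<in> trivs M"
    unfolding M_def conj_bundle_def pullback_bundle_def line_bundle.simps
    by (rule CollectI, rule exI[of _ "\<sigma> -` V"], rule exI[of _ "\<lambda>(x, v). \<rho> v"], rule conjI[OF refl],
        rule CollectI, rule exI[of _ V], rule exI[of _ \<rho>], rule conjI[OF refl V])
  have R: "(R, \<omega>) \<in> total_atlas A M"
    unfolding total_atlas_def R_def \<omega>_def
    by (rule CollectI, rule exI[of _ W], rule exI[of _ \<phi>], rule exI[of _ "\<sigma> -` V"],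
        rule exI[of _ "\<lambda>m. cnj ((\<lambda>(x, v). \<rho> v) m)"]) (simp add: W MV)
  have \<Psi>t: "\<Psi> v \<in> total M" "proj M (\<Psi> v) = proj L v" if "v \<in> total L" for v
    using \<Psi> that unfolding line_bundle_iso_def by (auto dest: bij_betwE)
  have \<Psi>s: "\<Psi> (fscale L c v) = fscale M c (\<Psi> v)" if "v \<in> total L" for v c
    using \<Psi> that unfolding line_bundle_iso_def fibrewise_linear_def by simp
  have "holomorphic_map (total_atlas A L) (total_atlas A M) \<Psi>"
    using \<Psi> unfolding line_bundle_iso_def by (elim conjE)
  note holo = manifold_mapD[OF this Q R]
  \<comment> \<open>The fibre coordinate of \<Psi> along the local frame: \<open>(z, 1)\<close>
    describes the vector of coordinate 1 over the point with coordinate \<open>z\<close>.\<close>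
  define P where "P z = snd ((\<omega> \<circ> \<Psi> \<circ> inv_into Q \<kappa>) (z, 1))" for z
  have frame: "inv_into Q \<kappa> (\<phi> x, 1) \<in> total L \<and> proj L (inv_into Q \<kappa> (\<phi> x, 1)) = x \<and>
      \<tau> (inv_into Q \<kappa> (\<phi> x, 1)) = 1 \<and> (\<phi> x, 1) = \<kappa> (inv_into Q \<kappa> (\<phi> x, 1))"
    if x: "x \<in> W \<inter> U" for x
  proof -
    obtain e where e: "e \<in> total L" "proj L e = x" "\<tau> e = 1"
      using triv_surj[OF L U, of x 1] x by auto
    then have "(\<phi> x, 1) \<in> \<kappa> ` Q"
      using x by (intro image_eqI[of _ _ e]) (simp_all add: Q_def \<kappa>_def)
    then have *: "inv_into Q \<kappa> (\<phi> x, 1) \<in> Q" "\<kappa> (inv_into Q \<kappa> (\<phi> x, 1)) = (\<phi> x, 1)"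
      by (rule inv_into_into, rule f_inv_into_f)
    define f where "f = inv_into Q \<kappa> (\<phi> x, 1)"
    have f: "f \<in> total L" "proj L f \<in> W" "\<phi> (proj L f) = \<phi> x" "\<tau> f = 1" "\<kappa> f = (\<phi> x, 1)"
      using * unfolding f_def[symmetric] by (simp_all add: Q_def \<kappa>_def)
    have "proj L f = x" using inj_onD[OF chart_inverse(4)[OF A W] f(3)] f(2) x by blast
    then show ?thesis using f unfolding f_def by simp
  qed
  show thesis
  proof
    show "holo_on (\<phi> ` (W \<inter> U \<inter> \<sigma> -` V)) P"
      unfolding holo_on_def
    proof
      fix z assume "z \<in> \<phi> ` (W \<inter> U \<inter> \<sigma> -` V)"
      then obtain x where x: "z = \<phi> x" "x \<in> W" "x \<in> U" "\<sigma> x \<in> V" by blast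
      then have "(z, 1) \<in> \<kappa> ` (Q \<inter> \<Psi> -` R)"
        using frame[of x] \<Psi>t by (intro image_eqI[of _ _ "inv_into Q \<kappa> (\<phi> x, 1)"]) (auto simp: Q_def R_def)
      then obtain f' where f': "((\<omega> \<circ> \<Psi> \<circ> inv_into Q \<kappa>) has_derivative f') (at (z, 1))"
        "\<forall>c v. f' (c *\<^sub>C v) = c *\<^sub>C f' v"
        using holo unfolding holo_on_def by meson
      \<comment> \<open>Restriction of the derivative on the total space to directions that leave
        the fibre coordinate at 1.\<close>
      have "((\<lambda>z. (z, 1)) has_derivative (\<lambda>h. (h, 0))) (at z)"
        by (auto intro!: derivative_eq_intros)
      from has_derivative_snd[OF has_derivative_compose[OF this f'(1)]]
      have "(P has_derivative (\<lambda>h. snd (f' (h, 0)))) (at z)" by (simp add: P_def[abs_def])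
      moreover have "snd (f' (c *\<^sub>C h, 0)) = c *\<^sub>C snd (f' (h, 0))" for c h
        using f'(2)[rule_format, of c "(h, 0)"] by (simp add: scaleC_prod_def)
      ultimately show "\<exists>f'. (P has_derivative f') (at z) \<and> (\<forall>c v. f' (c *\<^sub>C v) = c *\<^sub>C f' v)"
        by (intro exI[of _ "\<lambda>h. snd (f' (h, 0))"]) simp
    qed
    fix v assume v: "v \<in> total L" "proj L v \<in> W \<inter> U \<inter> \<sigma> -` V"
    define e where "e = inv_into Q \<kappa> (\<phi> (proj L v), 1)"
    have e: "e \<in> total L" "proj L e = proj L v" "\<tau> e = 1" using frame[of "proj L v"] v by (auto simp: e_def)
    have "\<Psi> v = fscale M (\<tau> v) (\<Psi> e)"
      using triv_fscale_decompose[OF L U v(1) e(1)] e v \<Psi>s[OF e(1), of "\<tau> v"] by auto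
    moreover obtain x w where xw: "\<Psi> e = (x, w)" by fastforce
    moreover have "w \<in> total L" "proj L w \<in> V"
      using \<Psi>t[OF e(1)] e(2) v(2) xw unfolding M_def conj_bundle_def pullback_bundle_def by auto
    ultimately show "cnj (\<rho> (snd (\<Psi> v))) = P (\<phi> (proj L v)) * \<tau> v"
      using triv_scale[OF L V, of w]
      unfolding P_def \<omega>_def by (simp add: M_def conj_bundle_def pullback_bundle_def flip: e_def)
  qed
qed

section \<open>Point evaluations on the embedded Hilbert space\<close>

lemma embedding_locally_bounded:
  assumes L: "holomorphic_line_bundle A L" and T: "intertwining_embedding G \<pi> A act L actL T"
    and U: "(U, \<tau>) \<in> trivs L" and C: "compact C" "C \<subseteq> U"
  obtains M where "\<And>v x. x \<in> C \<Longrightarrow> cmod (\<tau> (T v x)) \<le> M * norm v"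
proof -
  have sec: "T v \<in> holomorphic_sections A L" for v
    using T unfolding intertwining_embedding_def by blast
  have sc: "T (c *\<^sub>C v) x = fscale L c (T v x)" for c v x
    using T unfolding intertwining_embedding_def by blast
  have \<tau>: "\<tau> (T (c *\<^sub>C v) x) = c * \<tau> (T v x)" if "x \<in> U" for c v x
    using triv_scale[OF L U] sectionD[OF sec] that by (simp add: sc)
  \<comment> \<open>A basic neighbourhood of \<open>T 0\<close>. By continuity its preimage contains
    a ball of radius \<open>\<delta>\<close> about 0, and homogeneity turns this into a linear
    bound.\<close>
  define B where "B = {t \<in> holomorphic_sections A L. \<forall>x\<in>C. cmod (\<tau> (t x) - \<tau> (T 0 x)) < 1}"
  have "openin (section_topology A L) B"
    unfolding section_topology_def B_def
    by (rule topology_generated_by_Basis) (use U C sec zero_less_one in blast)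
  moreover have "continuous_map euclidean (section_topology A L) T"
    using T unfolding intertwining_embedding_def by blast
  ultimately have "open {v. T v \<in> B}"
    using openin_continuous_map_preimage by fastforce
  moreover have "0 \<in> {v. T v \<in> B}" using sec by (simp add: B_def)
  ultimately obtain \<delta> where \<delta>: "\<delta> > 0" "ball 0 \<delta> \<subseteq> {v. T v \<in> B}"
    using open_contains_ball by metis
  have "cmod (\<tau> (T v x)) \<le> 2 / \<delta> * norm v" if x: "x \<in> C" for v x
  proof -
    have xU: "x \<in> U" using x C(2) by blast
    have z: "\<tau> (T 0 x) = 0" using \<tau>[OF xU, of 0 0] by simp
    show ?thesis
    proof (cases "v = 0")
      case False
      \<comment> \<open>Scales \<open>v\<close> to norm \<open>\<delta> / 2\<close>, inside that
        ball.\<close>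
      define r where "r = \<delta> / (2 * norm v)"
      have r: "r > 0" using False \<delta>(1) by (simp add: r_def)
      have "norm (complex_of_real r *\<^sub>C v) = r * norm v" using r by (simp add: norm_scaleC)
      then have "norm (complex_of_real r *\<^sub>C v) < \<delta>" using False \<delta>(1) by (simp add: r_def)
      then have "cmod (\<tau> (T (complex_of_real r *\<^sub>C v) x) - \<tau> (T 0 x)) < 1"
        using \<delta>(2) x unfolding B_def by (auto simp: subset_iff)
      then have "r * cmod (\<tau> (T v x)) < 1" using r by (simp add: \<tau>[OF xU] z norm_mult)
      then show ?thesis using False \<delta>(1) by (simp add: r_def field_simps)
    qed (simp add: z)
  qed
  then show thesis using that by blast
qed

text \<open>Evaluation is bounded by the case of a one-point compact set. The representing vectors
  are the reproducing kernel of the embedded Hilbert space, read in a fibre coordinate.\<close>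

lemma evaluation_representer:
  assumes L: "holomorphic_line_bundle A L"
    and T: "intertwining_embedding G \<pi> A act L actL (T :: 'v::chilbert_space \<Rightarrow> _)"
    and U: "(U, \<tau>) \<in> trivs L" "x \<in> U"
  shows "\<exists>k. \<forall>v. \<tau> (T v x) = cinner v k"
proof (rule riesz_representation)
  have sec: "T v \<in> holomorphic_sections A L" for v
    using T unfolding intertwining_embedding_def by blast
  have sc: "T (c *\<^sub>C v) x = fscale L c (T v x)" for c v
    using T unfolding intertwining_embedding_def by blast
  have ad: "T (v + w) x = fadd L (T v x) (T w x)" for v w
    using T unfolding intertwining_embedding_def by blast
  show \<tau>: "\<tau> (T (c *\<^sub>C v) x) = c * \<tau> (T v x)" for c v
    using triv_scale[OF L U(1)] sectionD[OF sec] U(2) by (simp add: sc)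
  obtain M where "\<And>v. cmod (\<tau> (T v x)) \<le> M * norm v"
    using embedding_locally_bounded[OF L T U(1), of "{x}"] U(2) by auto
  then show "bounded_linear (\<lambda>v. \<tau> (T v x))"
    using triv_add[OF L U(1)] sectionD[OF sec] U(2) \<tau>[of "complex_of_real _"]
    by (intro bounded_linear_intro[of _ M])
      (auto simp: ad scaleC_of_real scaleR_conv_of_real mult.commute)
qed

text \<open>Here connectedness of the manifold enters: \<open>T v\<close> vanishes everywhere, so it
  coincides with \<open>T 0\<close>, and \<open>T\<close> is injective. In terms of representers,
  those over any nonempty open subset of \<open>U\<close> are total.\<close>

lemma embedding_injective_on_open:
  assumes A: "complex_manifold A" and conn: "connected (UNIV::'d::{t2_space,second_countable_topology} set)"
    and L: "holomorphic_line_bundle A (L::('l,'d) line_bundle)"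
    and T: "intertwining_embedding G \<pi> A act L actL T"
    and N: "open N" "N \<noteq> {}" and U: "(U, \<tau>) \<in> trivs L" "N \<subseteq> U"
    and zero: "\<And>x. x \<in> N \<Longrightarrow> \<tau> (T v x) = 0"
  shows "v = 0"
proof -
  have sec: "T v \<in> holomorphic_sections A L" for v
    using T unfolding intertwining_embedding_def by blast
  have sc: "T (c *\<^sub>C v) x = fscale L c (T v x)" for c v x
    using T unfolding intertwining_embedding_def by blast
  have "T v x = T 0 x" for x
  proof -
    obtain V \<rho> where V: "(V, \<rho>) \<in> trivs L" "x \<in> V" using bundle_triv[OF L] .
    have "\<rho> (T v x) = 0"
    proof (rule section_identity_theorem[OF A conn L sec N _ V])
      fix y V \<rho> assume "y \<in> N" "(V, \<rho>) \<in> trivs L" "y \<in> V"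
      then show "\<rho> (T v y) = 0"
        using triv_eq_0[OF L U(1)] sectionD[OF sec] zero U(2) by (metis subsetD)
    qed
    moreover have "\<rho> (T 0 x) = 0"
      using triv_scale[OF L V(1), of "T 0 x" 0] sectionD[OF sec] V(2) sc[of 0 0 x] by simp
    ultimately show ?thesis using triv_inj[OF L V(1)] sectionD[OF sec] V(2) by metis
  qed
  then show ?thesis using T unfolding intertwining_embedding_def by (blast dest: injD)
qed

text \<open>The factor \<open>\<bar>p / q\<bar>\<close> need not be constant, so \<open>r\<close> is a square root of \<open>p / cnj q\<close>, which
  exists only locally; a small ball suffices because \<open>K\<close> and \<open>K'\<close> are total on every open set.\<close>

lemma commute_if_kernels_conjugate_on_diagonal:
  fixes K K' :: "'e::complex_normed_vector \<Rightarrow> 'a::chilbert_space" and S :: "('a \<Rightarrow> 'a) set"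
  assumes D: "open D" "z0 \<in> D"
    and K: "\<And>v. holo_on D (\<lambda>z. cinner v (K z))"
    and K': "\<And>v. holo_on D (\<lambda>z. cnj (cinner v (K' z)))"
    and bddK: "\<And>C. compact C \<Longrightarrow> C \<subseteq> D \<Longrightarrow> \<exists>M. \<forall>z\<in>C. norm (K z) \<le> M"
    and bddK': "\<And>C. compact C \<Longrightarrow> C \<subseteq> D \<Longrightarrow> \<exists>M. \<forall>z\<in>C. norm (K' z) \<le> M"
    and totalK: "\<And>N v. open N \<Longrightarrow> N \<noteq> {} \<Longrightarrow> N \<subseteq> D \<Longrightarrow> (\<And>z. z \<in> N \<Longrightarrow> cinner v (K z) = 0) \<Longrightarrow> v = 0"
    and totalK': "\<And>N v. open N \<Longrightarrow> N \<noteq> {} \<Longrightarrow> N \<subseteq> D \<Longrightarrow> (\<And>z. z \<in> N \<Longrightarrow> cinner v (K' z) = 0) \<Longrightarrow> v = 0"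
    and p: "holo_on D p" "\<And>z. z \<in> D \<Longrightarrow> p z \<noteq> 0"
    and q: "holo_on D (\<lambda>z. cnj (q z))" "\<And>z. z \<in> D \<Longrightarrow> q z \<noteq> 0"
    and S: "\<And>A. A \<in> S \<Longrightarrow> bounded_linear A" "\<And>A c v. A \<in> S \<Longrightarrow> A (c *\<^sub>C v) = c *\<^sub>C A v"
    and S_id: "id \<in> S" and S_comp: "\<And>A B. A \<in> S \<Longrightarrow> B \<in> S \<Longrightarrow> A \<circ> B \<in> S"
    and diag: "\<And>A z. A \<in> S \<Longrightarrow> z \<in> D \<Longrightarrow>
      cinner (A (K' z)) (K' z) = complex_of_real (cmod (p z / q z)) * cinner (A (K z)) (K z)"
    and A: "A \<in> S" and B: "B \<in> S"
  shows "A \<circ> B = B \<circ> A"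
proof -
  define s where "s z = p z * inverse (cnj (q z))" for z
  have s: "holo_on D s" unfolding s_def
    by (intro holo_on_mult p holo_on_compose_field_differentiable[OF q(1)]
        field_differentiable_inverse field_differentiable_ident) (use q in auto)
  have s0: "s z0 \<noteq> 0" using p(2)[OF D(2)] q(2)[OF D(2)] by (simp add: s_def)
  have "isCont s z0" using holo_on_imp_continuous_on[OF s] D continuous_on_eq_continuous_at by blast
  then have "isCont (\<lambda>z. s z / s z0) z0" using s0 by (intro continuous_intros)
  moreover have "open {w. Re w > 0}" by (simp add: open_halfspace_Re_gt)
  ultimately obtain N where N: "open N" "z0 \<in> N" "\<And>z. z \<in> N \<Longrightarrow> Re (s z / s z0) > 0"
    using s0 unfolding continuous_at_open by (metis (mono_tags, lifting) divide_self mem_Collect_eq one_complex.simps(1) zero_less_one)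
  obtain \<epsilon> where \<epsilon>: "\<epsilon> > 0" "ball z0 \<epsilon> \<subseteq> D \<inter> N"
    using open_contains_ball[of "D \<inter> N"] N D by blast
  define Q where "Q = ball z0 \<epsilon>"
  have Q: "open Q" "convex Q" "Q \<noteq> {}" "Q \<subseteq> D" using \<epsilon> by (auto simp: Q_def)
  \<comment> \<open>Dividing by \<open>s z0\<close> first keeps the argument of the varying root in
    the right half-plane, off the branch cut, wherever \<open>s z0\<close> itself lies.\<close>
  define r where "r z = csqrt (s z0) * csqrt (s z * inverse (s z0))" for z
  have const: "holo_on Q (\<lambda>_. c)" for c :: complex
    unfolding holo_on_def by (auto intro!: exI[of _ "\<lambda>_. 0"])
  have "csqrt field_differentiable at (s z * inverse (s z0))" if "z \<in> Q" for z
  proof (rule field_differentiable_at_csqrt)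
    have "z \<in> N" using that \<epsilon>(2) by (auto simp: Q_def)
    then have "Re (s z * inverse (s z0)) > 0" using N(3) by (simp add: divide_inverse)
    then show "s z * inverse (s z0) \<notin> \<real>\<^sub>\<le>\<^sub>0" by (simp add: complex_nonpos_Reals_iff)
  qed
  then have "holo_on Q (\<lambda>z. csqrt (s z * inverse (s z0)))"
    by (rule holo_on_compose_field_differentiable[OF holo_on_mult[OF holo_on_subset[OF s Q(4)] const]])
  then have r: "holo_on Q r" unfolding r_def by (rule holo_on_mult[OF const])
  have r_sq: "(r z)\<^sup>2 = s z" for z
    using s0 by (simp add: r_def power_mult_distrib)
  have r0: "r z \<noteq> 0" if "z \<in> Q" for z
  proof -
    have "s z \<noteq> 0" using p(2)[of z] q(2)[of z] that Q(4) by (auto simp: s_def)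
    then show ?thesis using r_sq[of z] by auto
  qed
  have r_pq: "r z * cnj (r z) = complex_of_real (cmod (p z / q z))" for z
  proof -
    have "cmod (r z) ^ 2 = cmod (p z / q z)"
      using arg_cong[OF r_sq[of z], of cmod] by (simp add: norm_power s_def norm_mult norm_inverse norm_divide divide_inverse)
    then show ?thesis by (metis complex_norm_square)
  qed
  have kernel: "cinner (C (K' z)) (K' w) = r z * cnj (r w) * cinner (C (K w)) (K z)"
    if C: "C \<in> S" and z: "z \<in> Q" and w: "w \<in> Q" for C z w
  proof -
    \<comment> \<open>Trades \<open>C\<close> for a fixed vector, so that the holomorphy assumed for
      \<open>K\<close> and \<open>K'\<close> against fixed vectors applies when the varying vector
      stands behind \<open>C\<close>.\<close>
    have adj: "\<exists>y. \<forall>v. cinner (C v) x = cinner v y" for x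
      using bounded_linear_compose[OF bounded_linear_cinner_left S(1)[OF C]]
      by (intro riesz_representation) (simp_all add: S(2)[OF C] cinner_scaleC_left)
    define line where "line \<xi> = z + \<xi> *\<^sub>C (w - z)" for \<xi>
    define V where "V = {\<xi>. line \<xi> \<in> Q}"
    \<comment> \<open>The claim is \<open>g 0 1 = 0\<close>, the parameters of \<open>z\<close> and
      \<open>w\<close> on the line. The arguments of \<open>K\<close> are swapped because
      \<open>K\<close> is antiholomorphic and \<open>K'\<close> holomorphic; thus both terms are
      holomorphic in \<open>a\<close> and antiholomorphic in \<open>b\<close>.\<close>
    define g where "g a b = cinner (C (K' (line a))) (K' (line b))
        - r (line a) * cnj (r (line b)) * cinner (C (K (line b))) (K (line a))" for a b
    have hol: "(\<lambda>\<xi>. f (line \<xi>)) holomorphic_on V" if "holo_on D f \<or> holo_on Q f" for f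
      unfolding line_def V_def using that holo_on_subset[OF _ Q(4)] by (blast intro: holomorphic_on_complex_line)
    have "g 0 1 = 0"
    proof (rule polarization[of V g])
      show "open V" "connected V" unfolding V_def line_def using Q
        by (auto intro: open_complex_line convex_connected convex_complex_line)
      fix b
      obtain y where y: "\<And>v. cinner (C v) (K' (line b)) = cinner v y" using adj by blast
      have "(\<lambda>a. cnj (cinner y (K' (line a))) - r (line a) * cnj (r (line b)) * cinner (C (K (line b))) (K (line a))) holomorphic_on V"
        by (intro holomorphic_intros hol[of r] hol[OF disjI1[OF K]] hol[OF disjI1[OF K']] disjI2 r)
      then show "(\<lambda>a. g a b) holomorphic_on V"
        unfolding g_def y cinner_commute[of _ y] .
      obtain y where y: "\<And>v. cinner (C v) (K (line b)) = cinner v y" using adj by blast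
      have "(\<lambda>a. cnj (cinner (C (K' (line b))) (K' (line a))) - cnj (r (line b)) * r (line a) * cinner y (K (line a))) holomorphic_on V"
        by (intro holomorphic_intros hol[of r] hol[OF disjI1[OF K]] hol[OF disjI1[OF K']] disjI2 r)
      then show "(\<lambda>a. cnj (g b a)) holomorphic_on V"
        unfolding g_def y cinner_commute[of y] by simp
    next
      fix a assume "a \<in> V"
      then show "g a a = 0" using diag[OF C, of "line a"] Q(4)
        by (auto simp: g_def r_pq V_def)
    next
      have "line 0 = z" "line 1 = w" using scaleC_of_real[of 0 "w - z"] by (simp_all add: line_def)
      then show "0 \<in> V" "1 \<in> V" using z w by (simp_all add: V_def)
    next
      fix H assume H: "compact H" "H \<subseteq> V"
      have "continuous_on H line" unfolding line_def by (rule continuous_on_complex_line)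
      then have cH: "compact (line ` H)" using H(1) by (rule compact_continuous_image)
      have HQ: "line ` H \<subseteq> Q" using H(2) by (auto simp: V_def)
      obtain M1 where M1: "\<And>z. z \<in> line ` H \<Longrightarrow> norm (K z) \<le> M1" using bddK[OF cH] HQ Q(4) by blast
      obtain M2 where M2: "\<And>z. z \<in> line ` H \<Longrightarrow> norm (K' z) \<le> M2" using bddK'[OF cH] HQ Q(4) by blast
      have "compact (r ` line ` H)"
        using continuous_on_subset[OF holo_on_imp_continuous_on[OF r] HQ] cH by (rule compact_continuous_image)
      then obtain M3 where M3: "\<And>z. z \<in> line ` H \<Longrightarrow> norm (r z) \<le> M3"
        using compact_imp_bounded bounded_iff by (metis image_eqI)
      obtain MC where MC: "MC > 0" "\<And>v. norm (C v) \<le> norm v * MC"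
        using bounded_linear.pos_bounded[OF S(1)[OF C]] by blast
      have "cmod (g a b) \<le> M2 * MC * M2 + M3 * M3 * (M1 * MC * M1)" if "a \<in> H" "b \<in> H" for a b
      proof -
        have a: "line a \<in> line ` H" and b: "line b \<in> line ` H" using that by blast+
        have nn: "0 \<le> M1" "0 \<le> M2" "0 \<le> M3"
          using order_trans[OF norm_ge_zero] M1[OF a] M2[OF a] M3[OF a] by blast+
        have le: "cmod (cinner (C u) v) \<le> M * MC * M" if "norm u \<le> M" "norm v \<le> M" "0 \<le> M" for u v M
        proof -
          have "norm (C u) \<le> M * MC"
            using order_trans[OF MC(2) mult_right_mono[OF that(1)]] MC(1) by simp
          then show ?thesis
            using that(2,3) MC(1) by (intro order_trans[OF norm_cinner_le] mult_mono) simp_all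
        qed
        have "cmod (r (line a) * cnj (r (line b)) * cinner (C (K (line b))) (K (line a))) \<le> M3 * M3 * (M1 * MC * M1)"
          unfolding norm_mult complex_mod_cnj
          by (intro mult_mono M3 le M1 a b mult_nonneg_nonneg nn norm_ge_zero)
        then show ?thesis unfolding g_def
          by (intro order_trans[OF norm_triangle_ineq4] add_mono le M2 a b nn)
      qed
      then show "\<exists>M. \<forall>a\<in>H. \<forall>b\<in>H. cmod (g a b) \<le> M" by blast
    qed
    moreover have "line 0 = z" "line 1 = w" using scaleC_of_real[of 0 "w - z"] by (simp_all add: line_def)
    ultimately show ?thesis by (simp add: g_def)
  qed
  show ?thesis
  proof (rule commute_if_kernels_conjugate[of Q K "\<lambda>z. inverse (r z) *\<^sub>C K' z" S])
    show "v = 0" if "\<And>z. z \<in> Q \<Longrightarrow> cinner v (K z) = 0" for v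
      using Q(1,3,4) that by (rule totalK)
    show "v = 0" if "\<And>z. z \<in> Q \<Longrightarrow> cinner v (inverse (r z) *\<^sub>C K' z) = 0" for v
    proof (rule totalK'[OF Q(1,3,4)])
      show "cinner v (K' z) = 0" if "z \<in> Q" for z
        using \<open>\<And>z. z \<in> Q \<Longrightarrow> cinner v (inverse (r z) *\<^sub>C K' z) = 0\<close>[OF that] r0[OF that]
        by (simp add: cinner_scaleC_right)
    qed
    show "cinner (C (inverse (r z) *\<^sub>C K' z)) (inverse (r w) *\<^sub>C K' w) = cinner (C (K w)) (K z)"
      if "C \<in> S" "z \<in> Q" "w \<in> Q" for C z w
      using r0[OF that(2)] r0[OF that(3)]
      by (simp add: S(2)[OF that(1)] cinner_scaleC_left cinner_scaleC_right kernel[OF that] field_simps)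
  qed (use S S_id S_comp A B in auto)
qed

section \<open>Intertwining operators\<close>

lemma cinner_ext:
  assumes "\<And>v. cinner v x = cinner v y"
  shows "x = y"
proof -
  have "cinner (x - y) (x - y) = 0" using assms[of "x - y"] by (simp add: cinner_diff_right)
  then show ?thesis by (simp add: cinner_self)
qed

text \<open>Tested at \<open>v = k\<close>. For \<open>k = 0\<close> this says nothing about the
  sign of \<open>M\<close>, hence the absolute value.\<close>

lemma norm_le_if_cinner_le:
  assumes "\<And>v. cmod (cinner v k) \<le> M * norm v"
  shows "norm k \<le> \<bar>M\<bar>"
proof (cases "k = 0")
  case False
  have "norm k * norm k \<le> M * norm k"
    using assms[of k] unfolding cinner_self norm_of_real by (simp add: power2_eq_square)
  then have "norm k \<le> M" using False by (intro mult_right_le_imp_le[of "norm k" "norm k" M]) simp_all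
  then show ?thesis by linarith
qed simp

lemma unitary_representationD:
  assumes "unitary_representation G \<pi>" "group G" "g \<in> carrier G"
  shows unitary_cinner: "cinner (\<pi> g u) (\<pi> g v) = cinner u v"
    and unitary_norm: "norm (\<pi> g v) = norm v"
    and unitary_inverse: "\<pi> g (\<pi> (inv\<^bsub>G\<^esub> g) v) = v"
proof -
  show inner: "cinner (\<pi> g u) (\<pi> g v) = cinner u v" for u v
    using assms(1,3) unfolding unitary_representation_def by blast
  have "complex_of_real ((norm (\<pi> g v))\<^sup>2) = complex_of_real ((norm v)\<^sup>2)"
    using inner[of v v] by (simp add: cinner_self)
  then show "norm (\<pi> g v) = norm v" by (simp only: of_real_eq_iff power2_eq_iff_nonneg norm_ge_zero)
  have "\<pi> (g \<otimes>\<^bsub>G\<^esub> inv\<^bsub>G\<^esub> g) = \<pi> g \<circ> \<pi> (inv\<^bsub>G\<^esub> g)"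
    using assms(1,3) group.inv_closed[OF assms(2,3)] unfolding unitary_representation_def by blast
  moreover have "\<pi> \<one>\<^bsub>G\<^esub> = id" using assms(1) unfolding unitary_representation_def by blast
  ultimately have "\<pi> g \<circ> \<pi> (inv\<^bsub>G\<^esub> g) = id"
    using group.r_inv[OF assms(2,3)] by simp
  from fun_cong[OF this, of v] show "\<pi> g (\<pi> (inv\<^bsub>G\<^esub> g) v) = v" by simp
qed

text \<open>Unitarity moves \<open>\<pi> g\<close> across the inner product. Applied to evaluations,
  this turns equivariance of the embedding into a relation between the representers at a point and
  at its translate.\<close>

lemma unitary_representer:
  assumes \<pi>: "unitary_representation G \<pi>" "group G" "g \<in> carrier G"
    and k: "\<And>v. cinner (\<pi> g v) k' = c * cinner v k"
  shows "k' = cnj c *\<^sub>C \<pi> g k"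
proof (rule cinner_ext)
  fix v
  have "cinner v k' = c * cinner (\<pi> (inv\<^bsub>G\<^esub> g) v) k"
    using k[of "\<pi> (inv\<^bsub>G\<^esub> g) v"] by (simp add: unitary_inverse[OF \<pi>])
  also have "\<dots> = c * cinner v (\<pi> g k)"
    using unitary_cinner[OF \<pi>, of "\<pi> (inv\<^bsub>G\<^esub> g) v" k] by (simp add: unitary_inverse[OF \<pi>])
  finally show "cinner v k' = cinner v (cnj c *\<^sub>C \<pi> g k)" by (simp add: cinner_scaleC_right)
qed

text \<open>Identifies the set on which \<open>holomorphic_action\<close> lets the group act in the
  case of the bundle.\<close>

lemma Union_total_atlas:
  assumes A: "manifold_atlas C A" and L: "holomorphic_line_bundle A L"
  shows "\<Union>(fst ` total_atlas A L) = total L"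
proof (intro equalityI subsetI)
  fix v assume v: "v \<in> total L"
  obtain W \<phi> where W: "(W, \<phi>) \<in> A" "proj L v \<in> W" using manifold_atlas_chart[OF A] .
  obtain U \<tau> where U: "(U, \<tau>) \<in> trivs L" "proj L v \<in> U" using bundle_triv[OF L] .
  have "({v \<in> total L. proj L v \<in> W \<inter> U}, \<lambda>v. (\<phi> (proj L v), \<tau> v)) \<in> total_atlas A L"
    unfolding total_atlas_def
    by (rule CollectI, rule exI[of _ W], rule exI[of _ \<phi>], rule exI[of _ U], rule exI[of _ \<tau>])
      (simp add: W U)
  then show "v \<in> \<Union>(fst ` total_atlas A L)" using v W U by (intro UnionI[OF imageI]) auto
qed (auto simp: total_atlas_def)

section \<open>The isomorphism and the group action on single fibres\<close>

lemma conj_pullback_isoD: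
  assumes "line_bundle_iso A L (conj_bundle (pullback_bundle \<sigma> L)) \<Psi>" "v \<in> total L"
  shows "snd (\<Psi> v) \<in> total L" "proj L (snd (\<Psi> v)) = \<sigma> (proj L v)" "fst (\<Psi> v) = proj L v"
    "\<Psi> v \<in> total (pullback_bundle \<sigma> L)"
proof -
  have "\<Psi> v \<in> total (conj_bundle (pullback_bundle \<sigma> L))"
    using assms unfolding line_bundle_iso_def by (auto dest: bij_betwE)
  moreover have "proj (conj_bundle (pullback_bundle \<sigma> L)) (\<Psi> v) = proj L v"
    using assms unfolding line_bundle_iso_def by simp
  ultimately show "snd (\<Psi> v) \<in> total L" "proj L (snd (\<Psi> v)) = \<sigma> (proj L v)" "fst (\<Psi> v) = proj L v"
    "\<Psi> v \<in> total (pullback_bundle \<sigma> L)"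
    by (auto simp: conj_bundle_def pullback_bundle_def)
qed

text \<open>A zero factor would send the vectors of coordinates 1 and 0 over \<open>x\<close> to the
  same vector, against injectivity of \<Psi>.\<close>

lemma conj_pullback_iso_coordinate_nonzero:
  assumes L: "holomorphic_line_bundle A L"
    and \<Psi>: "line_bundle_iso A L (conj_bundle (pullback_bundle \<sigma> L)) \<Psi>"
    and U: "(U, \<tau>) \<in> trivs L" "x \<in> U" and V: "(V, \<rho>) \<in> trivs L" "\<sigma> x \<in> V"
    and c: "\<And>v. v \<in> total L \<Longrightarrow> proj L v = x \<Longrightarrow> cnj (\<rho> (snd (\<Psi> v))) = c * \<tau> v"
  shows "c \<noteq> 0"
proof
  assume c0: "c = 0"
  obtain v where v: "v \<in> total L" "proj L v = x" "\<tau> v = 1" using triv_surj[OF L U] .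
  obtain w where w: "w \<in> total L" "proj L w = x" "\<tau> w = 0" using triv_surj[OF L U] .
  note D = conj_pullback_isoD[OF \<Psi>]
  have "snd (\<Psi> v) = snd (\<Psi> w)"
    by (rule triv_inj[OF L V(1)]) (use D[OF v(1)] D[OF w(1)] v w V(2) c[OF v(1,2)] c[OF w(1,2)] c0 in simp_all)
  then have "\<Psi> v = \<Psi> w" using D(3)[OF v(1)] D(3)[OF w(1)] v w by (simp add: prod_eq_iff)
  moreover have "inj_on \<Psi> (total L)" using \<Psi> unfolding line_bundle_iso_def by (blast intro: bij_betw_imp_inj_on)
  ultimately have "v = w" using v(1) w(1) by (blast dest: inj_onD)
  then show False using v w by simp
qed

text \<open>A linear map between one-dimensional fibres is multiplication by a scalar, here the
  coordinate of the image of the vector of coordinate 1.\<close>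

lemma action_coordinate:
  assumes L: "holomorphic_line_bundle A L"
    and act_total: "\<forall>v\<in>total L. actL h v \<in> total L \<and> proj L (actL h v) = act h (proj L v)"
    and lin: "fibrewise_linear L L (actL h)"
    and U: "(U, \<tau>) \<in> trivs L" "x \<in> U" and V: "(V, \<rho>) \<in> trivs L" "act h x \<in> V"
  obtains c where "\<And>v. v \<in> total L \<Longrightarrow> proj L v = x \<Longrightarrow> \<rho> (actL h v) = c * \<tau> v"
proof -
  obtain e where e: "e \<in> total L" "proj L e = x" "\<tau> e = 1" using triv_surj[OF L U] .
  have "\<rho> (actL h v) = \<rho> (actL h e) * \<tau> v" if v: "v \<in> total L" "proj L v = x" for v
  proof -
    have "v = fscale L (\<tau> v) e"
      using triv_fscale_decompose[OF L U(1) v(1) e(1)] e v U by simp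
    then have "actL h v = fscale L (\<tau> v) (actL h e)"
      using lin e(1) unfolding fibrewise_linear_def by metis
    then show ?thesis
      using triv_scale[OF L V(1), of "actL h e" "\<tau> v"] bspec[OF act_total e(1)] e(2) V(2) by simp
  qed
  then show thesis using that by blast
qed

lemma embedding_action:
  assumes T: "intertwining_embedding G \<pi> A act L actL T" and g: "g \<in> carrier G"
    and act: "act (inv\<^bsub>G\<^esub> g) (act g x) = x"
  shows "T (\<pi> g v) (act g x) = actL g (T v x)"
  using T g act unfolding intertwining_embedding_def section_action_def by simp

theorem theorem2p2:
  fixes G :: "'h::{t2_space, second_countable_topology} monoid"
    and AG :: "('h, 'm::real_normed_vector) chart set"
    and \<pi> :: "'h \<Rightarrow> 'v::chilbert_space \<Rightarrow> 'v"
    and A :: "('d::{t2_space, second_countable_topology}, 'e::complex_normed_vector) chart set"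
    and act :: "'h \<Rightarrow> 'd \<Rightarrow> 'd"
    and L :: "('l, 'd) line_bundle"
    and actL :: "'h \<Rightarrow> 'l \<Rightarrow> 'l"
    and \<sigma> :: "'d \<Rightarrow> 'd"
  assumes lie_group: "lie_group G AG"
    and unitary: "unitary_representation G \<pi>"
    and manifold: "complex_manifold A"
    and connectedness: "connected (UNIV :: 'd set)"
    and equivariant: "equivariant_line_bundle G AG A act L actL"
    and antiholomorphic: "antiholomorphic_map A A \<sigma>"
    and involutive: "\<sigma> \<circ> \<sigma> = id"
    and a: "\<exists>T. intertwining_embedding G \<pi> A act L actL T"
    and b: "\<exists>\<theta>\<in>iso G G. (\<forall>h x. \<sigma> (act h x) = act (\<theta> h) (\<sigma> x)) \<and>
              (\<exists>\<Psi>. equivariant_line_bundle_iso G AG A act L actL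
                     (conj_bundle (pullback_bundle \<sigma> L)) (pullback_action \<sigma> \<theta> act L actL) \<Psi>)"
    and c: "\<forall>x. \<exists>g\<in>carrier G. \<sigma> x = act g x"
  shows "cring (intertwiner_ring G \<pi>) \<and> multiplicity_free G \<pi>"
proof -
  have G: "group G" "carrier G = UNIV" using lie_group unfolding lie_group_def by simp_all
  have g_in: "g \<in> carrier G" for g by (simp add: G(2))
  have atlas: "manifold_atlas holo_on A" using manifold unfolding complex_manifold_def .
  have L: "holomorphic_line_bundle A L" using equivariant unfolding equivariant_line_bundle_def by (elim conjE)
  obtain T where T: "intertwining_embedding G \<pi> A act L actL T" using a ..
  obtain \<theta> \<Psi> where \<sigma>_act: "\<And>h x. \<sigma> (act h x) = act (\<theta> h) (\<sigma> x)"
    and \<Psi>_eq: "equivariant_line_bundle_iso G AG A act L actL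
       (conj_bundle (pullback_bundle \<sigma> L)) (pullback_action \<sigma> \<theta> act L actL) \<Psi>"
    using b by (elim bexE conjE exE) simp
  have \<Psi>: "line_bundle_iso A L (conj_bundle (pullback_bundle \<sigma> L)) \<Psi>"
    using \<Psi>_eq unfolding equivariant_line_bundle_iso_def by (elim conjE)
  have \<Psi>_act: "snd (\<Psi> (actL h v)) = actL (\<theta> h) (snd (\<Psi> v))" if v: "v \<in> total L" for h v
  proof -
    have "\<Psi> (actL h v) = pullback_action \<sigma> \<theta> act L actL h (\<Psi> v)"
      using \<Psi>_eq v g_in unfolding equivariant_line_bundle_iso_def by simp
    then show ?thesis
      using conj_pullback_isoD(4)[OF \<Psi> v] by (simp add: pullback_action_def split_def)
  qed
  have \<sigma>\<sigma>: "\<sigma> (\<sigma> x) = x" for x using involutive by (metis comp_apply id_apply)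
  have act: "group_action G UNIV act"
    using equivariant atlas
    unfolding equivariant_line_bundle_def holomorphic_action_def manifold_atlas_def by simp
  have act_inv: "act (inv\<^bsub>G\<^esub> g) (act g x) = x" for g x
    using group_action.orbit_sym_aux[OF act g_in UNIV_I refl] .
  have "group_action G (total L) actL"
    using equivariant unfolding equivariant_line_bundle_def holomorphic_action_def
    by (simp add: Union_total_atlas[OF atlas L])
  from group_action.element_image[OF this g_in _ refl] equivariant
  have actL: "actL h v \<in> total L \<and> proj L (actL h v) = act h (proj L v)" if "v \<in> total L" for h v
    using that g_in unfolding equivariant_line_bundle_def by simp
  have actL_lin: "fibrewise_linear L L (actL h)" for h
    using equivariant g_in unfolding equivariant_line_bundle_def by simp
  have sec: "T v \<in> holomorphic_sections A L" for v
    using T unfolding intertwining_embedding_def by blast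
  have T_act: "T (\<pi> g v) (act g x) = actL g (T v x)" for g v x
    using embedding_action[OF T g_in act_inv] .
  have \<sigma>_cont: "continuous_on UNIV \<sigma>"
    by (rule manifold_map_continuous[OF atlas atlas antiholomorphic antiholo_on_imp_continuous_on])

  \<comment> \<open>An arbitrary base point; all further work takes place in charts and
    trivializations about it and about its mirror image.\<close>
  obtain x0 :: 'd where True by blast
  obtain W \<phi> where W: "(W, \<phi>) \<in> A" "x0 \<in> W" using manifold_atlas_chart[OF atlas] .
  obtain W' \<phi>' where W': "(W', \<phi>') \<in> A" "\<sigma> x0 \<in> W'" using manifold_atlas_chart[OF atlas] .
  obtain U \<tau> where U: "(U, \<tau>) \<in> trivs L" "x0 \<in> U" using bundle_triv[OF L] .
  obtain U' \<tau>' where U': "(U', \<tau>') \<in> trivs L" "\<sigma> x0 \<in> U'" using bundle_triv[OF L] .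
  define \<xi> where "\<xi> = inv_into W \<phi>"
  \<comment> \<open>The coordinates of those points near \<open>x0\<close> that lie in the first
    chart and trivialization while their images under \<sigma> lie in the second.\<close>
  define D where "D = \<phi> ` (W \<inter> (U \<inter> \<sigma> -` (W' \<inter> U')))"
  have "open (\<sigma> -` (W' \<inter> U'))"
    using open_vimage[OF open_Int[OF manifold_atlasD(1)[OF atlas W'(1)] triv_open[OF L U'(1)]] \<sigma>_cont] .
  then have D: "open D" "\<phi> x0 \<in> D"
    using chart_open_image[OF atlas W(1) open_Int[OF triv_open[OF L U(1)]]] W U W' U'
    by (simp_all add: D_def)
  have \<xi>: "\<xi> z \<in> W" "\<xi> z \<in> U" "\<sigma> (\<xi> z) \<in> W'" "\<sigma> (\<xi> z) \<in> U'" "\<phi> (\<xi> z) = z" if "z \<in> D" for z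
    using that by (auto simp: D_def \<xi>_def chart_inverse(1)[OF atlas W(1)])
  have D_sub: "D \<subseteq> \<phi> ` (W \<inter> U)" "D \<subseteq> \<phi> ` W" "D \<subseteq> \<phi> ` (W \<inter> U \<inter> \<sigma> -` U')" "D \<subseteq> \<phi> ` (W \<inter> \<sigma> -` W')"
    by (auto simp: D_def)
  have \<xi>_cont: "continuous_on D \<xi>"
    unfolding \<xi>_def using continuous_on_subset[OF chart_inverse(3)[OF atlas W(1)] D_sub(2)] .
  have \<xi>_open: "open (\<xi> ` N)" if "open N" "N \<subseteq> D" for N
    unfolding \<xi>_def using chart_inverse_open_image[OF atlas W(1) that(1)] that(2) D_sub(2) by blast
  have \<sigma>_anti: "antiholo_on D (\<phi>' \<circ> \<sigma> \<circ> \<xi>)"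
    using manifold_mapD[OF antiholomorphic W(1) W'(1)] D_sub(4)
    unfolding antiholo_on_def \<xi>_def by blast

  obtain K where K: "\<And>z v. z \<in> D \<Longrightarrow> \<tau> (T v (\<xi> z)) = cinner v (K z)"
    using evaluation_representer[OF L T U(1) \<xi>(2)] by metis
  obtain K' where K': "\<And>z v. z \<in> D \<Longrightarrow> \<tau>' (T v (\<sigma> (\<xi> z))) = cinner v (K' z)"
    using evaluation_representer[OF L T U'(1) \<xi>(4)] by metis
  \<comment> \<open>\<Psi> leads from the fibre over x to the one over \<sigma> x and also the other
    way; \<open>p\<close> and \<open>q\<close> are its factors over \<open>\<xi> z\<close> and over
    \<open>\<sigma> (\<xi> z)\<close>.\<close>
  obtain p where p: "holo_on (\<phi> ` (W \<inter> U \<inter> \<sigma> -` U')) p"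
    "\<And>v. v \<in> total L \<Longrightarrow> proj L v \<in> W \<inter> U \<inter> \<sigma> -` U' \<Longrightarrow>
       cnj (\<tau>' (snd (\<Psi> v))) = p (\<phi> (proj L v)) * \<tau> v"
    by (rule conj_pullback_iso_coordinate[OF L atlas \<Psi> W(1) U(1) U'(1)]) (rule that)
  obtain q where q: "holo_on (\<phi>' ` (W' \<inter> U' \<inter> \<sigma> -` U)) q"
    "\<And>v. v \<in> total L \<Longrightarrow> proj L v \<in> W' \<inter> U' \<inter> \<sigma> -` U \<Longrightarrow>
       cnj (\<tau> (snd (\<Psi> v))) = q (\<phi>' (proj L v)) * \<tau>' v"
    by (rule conj_pullback_iso_coordinate[OF L atlas \<Psi> W'(1) U'(1) U(1)]) (rule that)
  \<comment> \<open>Read as a function of the coordinate of x, the factor \<open>q\<close> is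
    composed with \<sigma> and becomes antiholomorphic.\<close>
  define q' where "q' z = q (\<phi>' (\<sigma> (\<xi> z)))" for z
  have p_fibre: "cnj (\<tau>' (snd (\<Psi> v))) = p z * \<tau> v"
    if "z \<in> D" "v \<in> total L" "proj L v = \<xi> z" for z v
    using p(2)[OF that(2)] \<xi>[OF that(1)] that(3) by simp
  have q_fibre: "cnj (\<tau> (snd (\<Psi> v))) = q' z * \<tau>' v"
    if "z \<in> D" "v \<in> total L" "proj L v = \<sigma> (\<xi> z)" for z v
    using q(2)[OF that(2)] \<xi>[OF that(1)] that(3) by (simp add: q'_def \<sigma>\<sigma>)

  let ?S = "carrier (intertwiner_ring G \<pi>)"
  have S: "bounded_linear B" "B (c *\<^sub>C v) = c *\<^sub>C B v" "B (\<pi> g v) = \<pi> g (B v)" if "B \<in> ?S" for B c v g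
    using that g_in by (auto simp: intertwiner_ring_def fun_eq_iff)
  have diag: "cinner (B (K' z)) (K' z) = complex_of_real (cmod (p z / q' z)) * cinner (B (K z)) (K z)"
    if B: "B \<in> ?S" and z: "z \<in> D" for B z
  proof -
    obtain g where g: "\<sigma> (\<xi> z) = act g (\<xi> z)" using c by blast
    \<comment> \<open>Applying \<sigma> to the equation for \<open>g\<close> shows that the partner
      \<open>\<theta> g\<close> leads from \<sigma> x back to x.\<close>
    have \<theta>g: "act (\<theta> g) (\<sigma> (\<xi> z)) = \<xi> z" using \<sigma>_act[of g "\<xi> z"] g \<sigma>\<sigma> by metis
    have in_U': "act g (\<xi> z) \<in> U'" using \<xi>(4)[OF z] g by simp
    have in_U: "act (\<theta> g) (\<sigma> (\<xi> z)) \<in> U" using \<xi>(2)[OF z] \<theta>g by simp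
    have actL_ball: "\<forall>v\<in>total L. actL h v \<in> total L \<and> proj L (actL h v) = act h (proj L v)" for h
      using actL by blast
    obtain c where c: "\<And>v. v \<in> total L \<Longrightarrow> proj L v = \<xi> z \<Longrightarrow> \<tau>' (actL g v) = c * \<tau> v"
      by (rule action_coordinate[where h = g and act = act and actL = actL, OF L actL_ball actL_lin U(1) \<xi>(2)[OF z] U'(1) in_U']) (rule that)
    obtain d where d: "\<And>v. v \<in> total L \<Longrightarrow> proj L v = \<sigma> (\<xi> z) \<Longrightarrow> \<tau> (actL (\<theta> g) v) = d * \<tau>' v"
      by (rule action_coordinate[where h = "\<theta> g" and act = act and actL = actL, OF L actL_ball actL_lin U'(1) \<xi>(4)[OF z] U(1) in_U]) (rule that)
    note \<pi> = unitary G(1) g_in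
    have K'K: "K' z = cnj c *\<^sub>C \<pi> g (K z)"
    proof (rule unitary_representer[OF \<pi>])
      fix v
      have "cinner (\<pi> g v) (K' z) = \<tau>' (actL g (T v (\<xi> z)))"
        using K'[OF z, of "\<pi> g v"] T_act[of g v "\<xi> z"] g by simp
      then show "cinner (\<pi> g v) (K' z) = c * cinner v (K z)"
        using c sectionD[OF sec] K[OF z] by simp
    qed
    have KK': "K z = cnj d *\<^sub>C \<pi> (\<theta> g) (K' z)"
    proof (rule unitary_representer[OF \<pi>])
      fix v
      have "cinner (\<pi> (\<theta> g) v) (K z) = \<tau> (actL (\<theta> g) (T v (\<sigma> (\<xi> z))))"
        using K[OF z, of "\<pi> (\<theta> g) v"] T_act[of "\<theta> g" v "\<sigma> (\<xi> z)"] \<theta>g by simp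
      then show "cinner (\<pi> (\<theta> g) v) (K z) = d * cinner v (K' z)"
        using d sectionD[OF sec] K'[OF z] by simp
    qed
    have lhs: "cinner (B (K' z)) (K' z) = complex_of_real ((cmod c)\<^sup>2) * cinner (B (K z)) (K z)"
      unfolding K'K complex_norm_square
      by (simp add: S[OF B] cinner_scaleC_left cinner_scaleC_right unitary_cinner[OF \<pi>])
    \<comment> \<open>If \<open>K z = 0\<close>, norms reveal nothing about \<open>c\<close> and
      \<open>d\<close>, but both sides vanish.\<close>
    show ?thesis
    proof (cases "K z = 0")
      case True
      then show ?thesis using lhs by simp
    next
      case False
      have "norm (K' z) = cmod c * norm (K z)" "norm (K z) = cmod d * norm (K' z)"
        using arg_cong[OF K'K, of norm] arg_cong[OF KK', of norm]
        by (simp_all add: norm_scaleC unitary_norm[OF \<pi>])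
      \<comment> \<open>Substituting one norm equation into the other and cancelling the nonzero
        \<open>norm (K z)\<close>.\<close>
      then have dc: "cmod d * cmod c = 1" using False by (auto simp: mult.commute)
      obtain e where e: "e \<in> total L" "proj L e = \<xi> z" "\<tau> e = 1"
        using triv_surj[OF L U(1) \<xi>(2)[OF z]] .
      \<comment> \<open>\<Psi> on \<open>actL g e\<close> is evaluated in two ways: by its factor
        over \<open>\<sigma> (\<xi> z)\<close>, and by equivariance, with \<open>\<theta> g\<close>
        acting on the image of \<open>e\<close>.\<close>
      have "q' z * \<tau>' (actL g e) = cnj (\<tau> (snd (\<Psi> (actL g e))))"
        using q_fibre[OF z] actL[OF e(1)] e(2) g by simp
      also have "\<dots> = cnj (d * \<tau>' (snd (\<Psi> e)))"
        using d conj_pullback_isoD[OF \<Psi> e(1)] e(2) by (simp add: \<Psi>_act[OF e(1)])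
      also have "\<dots> = cnj d * p z" using p_fibre[OF z e(1,2)] e(3) by simp
      finally have "cmod (q' z) * cmod c = cmod d * cmod (p z)"
        using c[OF e(1,2)] e(3) by (metis complex_mod_cnj mult.right_neutral norm_mult)
      then have "cmod (q' z) * (cmod c)\<^sup>2 = (cmod d * cmod c) * cmod (p z)"
        by (simp add: power2_eq_square mult_ac)
      then have "cmod (q' z) * (cmod c)\<^sup>2 = cmod (p z)" using dc by simp
      moreover have "q' z \<noteq> 0"
        using conj_pullback_iso_coordinate_nonzero[OF L \<Psi> U'(1) \<xi>(4)[OF z] U(1), of "q' z"]
          q_fibre[OF z] \<xi>(2)[OF z] by (simp add: \<sigma>\<sigma>)
      ultimately have "(cmod c)\<^sup>2 = cmod (p z / q' z)" by (simp add: norm_divide field_simps)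
      then show ?thesis using lhs by simp
    qed
  qed
  have comm: "B \<circ> C = C \<circ> B" if "B \<in> ?S" "C \<in> ?S" for B C
  proof (rule commute_if_kernels_conjugate_on_diagonal[where K = K and K' = K' and D = D
        and p = p and q = q' and S = ?S])
    show "open D" "\<phi> x0 \<in> D" by (fact D)+
    show "holo_on D (\<lambda>z. cinner v (K z))" for v
    proof (rule holo_on_cong[OF D(1)])
      show "holo_on D (\<lambda>z. \<tau> (T v (\<xi> z)))"
        using holo_on_subset[OF holo_on_section_coordinate[OF sec W(1) U(1)] D_sub(1)] by (simp add: \<xi>_def)
    qed (rule K)
    show "holo_on D (\<lambda>z. cnj (cinner v (K' z)))" for v
    proof (rule holo_on_cong[OF D(1)])
      show "holo_on D (\<lambda>z. cnj (\<tau>' (T v (inv_into W' \<phi>' ((\<phi>' \<circ> \<sigma> \<circ> \<xi>) z)))))"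
        using \<sigma>_anti holo_on_section_coordinate[OF sec W'(1) U'(1)]
        by (rule holo_on_cnj_antiholo) (use \<xi> in auto)
      show "cnj (\<tau>' (T v (inv_into W' \<phi>' ((\<phi>' \<circ> \<sigma> \<circ> \<xi>) z)))) = cnj (cinner v (K' z))" if "z \<in> D" for z
        using K'[OF that] \<xi>(3)[OF that] by (simp add: chart_inverse(1)[OF atlas W'(1)])
    qed
    show "\<exists>M. \<forall>z\<in>H. norm (K z) \<le> M" if H: "compact H" "H \<subseteq> D" for H
    proof -
      have "compact (\<xi> ` H)" using continuous_on_subset[OF \<xi>_cont H(2)] H(1) by (rule compact_continuous_image)
      then obtain M where M: "\<And>v x. x \<in> \<xi> ` H \<Longrightarrow> cmod (\<tau> (T v x)) \<le> M * norm v"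
        using embedding_locally_bounded[OF L T U(1)] \<xi>(2) H(2) by (metis image_subsetI subsetD)
      have "norm (K z) \<le> \<bar>M\<bar>" if "z \<in> H" for z
        using M[OF imageI[OF that]] K[OF subsetD[OF H(2) that]] by (intro norm_le_if_cinner_le) simp
      then show ?thesis by blast
    qed
    show "\<exists>M. \<forall>z\<in>H. norm (K' z) \<le> M" if H: "compact H" "H \<subseteq> D" for H
    proof -
      have "continuous_on H (\<lambda>z. \<sigma> (\<xi> z))"
        using continuous_on_compose2[OF \<sigma>_cont continuous_on_subset[OF \<xi>_cont H(2)]] by simp
      then have "compact ((\<lambda>z. \<sigma> (\<xi> z)) ` H)" using H(1) by (rule compact_continuous_image)
      then obtain M where M: "\<And>v x. x \<in> (\<lambda>z. \<sigma> (\<xi> z)) ` H \<Longrightarrow> cmod (\<tau>' (T v x)) \<le> M * norm v"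
        using embedding_locally_bounded[OF L T U'(1)] \<xi>(4) H(2) by (metis (no_types, lifting) image_subsetI subsetD)
      have "norm (K' z) \<le> \<bar>M\<bar>" if "z \<in> H" for z
        using M[OF imageI[OF that]] K'[OF subsetD[OF H(2) that]] by (intro norm_le_if_cinner_le) simp
      then show ?thesis by blast
    qed
    show "v = 0" if N: "open N" "N \<noteq> {}" "N \<subseteq> D" and v: "\<And>z. z \<in> N \<Longrightarrow> cinner v (K z) = 0" for N v
    proof (rule embedding_injective_on_open[OF manifold connectedness L T \<xi>_open[OF N(1,3)] _ U(1)])
      show "\<xi> ` N \<noteq> {}" using N(2) by simp
      show "\<xi> ` N \<subseteq> U" using \<xi>(2) N(3) by (intro image_subsetI) (rule \<xi>(2), rule subsetD)
      show "\<tau> (T v x) = 0" if x: "x \<in> \<xi> ` N" for x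
        using x by (rule imageE) (simp add: K[OF subsetD[OF N(3)]] v)
    qed
    show "v = 0" if N: "open N" "N \<noteq> {}" "N \<subseteq> D" and v: "\<And>z. z \<in> N \<Longrightarrow> cinner v (K' z) = 0" for N v
    proof (rule embedding_injective_on_open[OF manifold connectedness L T _ _ U'(1)])
      \<comment> \<open>For an involution images are preimages, so continuity of \<sigma> makes the
        image open.\<close>
      have "\<sigma> ` \<xi> ` N = \<sigma> -` \<xi> ` N"
      proof (intro equalityI subsetI)
        fix x assume "x \<in> \<sigma> -` \<xi> ` N"
        then show "x \<in> \<sigma> ` \<xi> ` N" by (intro image_eqI[of _ _ "\<sigma> x"]) (simp_all add: \<sigma>\<sigma>)
      qed (use \<sigma>\<sigma> in auto)
      then show "open (\<sigma> ` \<xi> ` N)" using open_vimage[OF \<xi>_open[OF N(1,3)] \<sigma>_cont] by simp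
      show "\<sigma> ` \<xi> ` N \<noteq> {}" using N(2) by simp
      show "\<sigma> ` \<xi> ` N \<subseteq> U'" unfolding image_image by (intro image_subsetI) (rule \<xi>(4), rule subsetD[OF N(3)])
      show "\<tau>' (T v x) = 0" if x: "x \<in> \<sigma> ` \<xi> ` N" for x
        using x unfolding image_image by (rule imageE) (simp add: K'[OF subsetD[OF N(3)]] v)
    qed
    show "holo_on D p" using holo_on_subset[OF p(1) D_sub(3)] .
    show "p z \<noteq> 0" if z: "z \<in> D" for z
      using conj_pullback_iso_coordinate_nonzero[OF L \<Psi> U(1) \<xi>(2)[OF z] U'(1) \<xi>(4)[OF z], of "p z"]
        p_fibre[OF z] by simp
    have "(\<phi>' \<circ> \<sigma> \<circ> \<xi>) ` D \<subseteq> \<phi>' ` (W' \<inter> U' \<inter> \<sigma> -` U)"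
      using \<xi> by (intro image_subsetI) (simp add: \<sigma>\<sigma>)
    from holo_on_cnj_antiholo[OF \<sigma>_anti q(1) this] show "holo_on D (\<lambda>z. cnj (q' z))"
      by (simp add: q'_def)
    show "q' z \<noteq> 0" if z: "z \<in> D" for z
      using conj_pullback_iso_coordinate_nonzero[OF L \<Psi> U'(1) \<xi>(4)[OF z] U(1), of "q' z"]
        q_fibre[OF z] \<xi>(2)[OF z] by (simp add: \<sigma>\<sigma>)
    note R = ring.is_monoid[OF ring_intertwiner_ring[OF unitary]]
    show "id \<in> ?S" using monoid.one_closed[OF R] by (simp add: intertwiner_ring_def)
    show "B \<circ> C \<in> ?S" if "B \<in> ?S" "C \<in> ?S" for B C
      using monoid.m_closed[OF R that] by (simp add: intertwiner_ring_def)
  qed (use that S diag in simp_all)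
  interpret R: ring "intertwiner_ring G \<pi>" using unitary by (rule ring_intertwiner_ring)
  have "cring (intertwiner_ring G \<pi>)"
  proof
    show "B \<otimes>\<^bsub>intertwiner_ring G \<pi>\<^esub> C = C \<otimes>\<^bsub>intertwiner_ring G \<pi>\<^esub> B"
      if "B \<in> ?S" "C \<in> ?S" for B C
      using comm[OF that] by (simp add: intertwiner_ring_def)
  qed
  then show ?thesis by (simp add: multiplicity_free_def)
qed

end
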